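(* Let $(M,g)$ be a Riemannian manifold of dimension $n$, let $q\ge1$ and $2q\le r\le n-2q$, and at each point write $R^q=\sum_{i=0}^{2q}g^{2q-i}\omega_i$ with $\omega_i$ effective in $D^{i,i}$. Let $\lambda$ be a real constant, and let $P$ range over all tangent $r$-planes of $M$. (1) Suppose $n\neq 2r$. (a) $s_{(r,q)}(P)-s_{(n-r,q)}(P^\perp)=\lambda$ for all $P$ if and only if $\omega_i=0$ for $1\le i\le 2q-1$ and $\Big(\frac{(n-r)!}{(n-2q-r)!}-\frac{r!}{(r-2q)!}\Big)\omega_0=\lambda$. (b) $s_{(r,q)}(P)+s_{(n-r,q)}(P^\perp)=\lambda$ for all $P$ if and only if $\omega_i=0$ for $1\le i\le 2q$ and $\Big(\frac{(n-r)!}{(n-2q-r)!}+\frac{r!}{(r-2q)!}\Big)\omega_0=\lambda$; that is, $R^q$ has constant sectional curvature. (2) Suppose $n=2r$. (a) $s_{(r,q)}(P)-s_{(r,q)}(P^\perp)=\lambda$ for all $P$ if and only if $\omega_i=0$ for all odd $i$ with $1\le i\le 2q-1$ and $\lambda=0$. (b) $s_{(r,q)}(P)+s_{(r,q)}(P^\perp)=\lambda$ for all $P$ if and only if $\omega_i=0$ for all even $i$ with $2\le i\le 2q$ and $2\frac{r!}{(r-2q)!}\omega_0=\lambda$.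
   Context: For each tangent space $V=T_mM$ let $D^{p,q}=\Lambda^pV^*\otimes\Lambda^qV^*$, identified with bilinear forms $\Lambda^pV\times\Lambda^qV\to\mathbb R$ (wedges of distinct elements of a dual basis evaluate to $1$ on the corresponding wedges of basis vectors), with product $(\theta_1\otimes\theta_2)\cdot(\theta_3\otimes\theta_4)=(\theta_1\wedge\theta_3)\otimes(\theta_2\wedge\theta_4)$; $g\in D^{1,1}$. The contraction $c:D^{p,q}\to D^{p-1,q-1}$ is $c\omega(x_1\wedge\dots,y_1\wedge\dots)=\sum_{j=1}^n\omega(e_j\wedge x_1\wedge\dots,e_j\wedge y_1\wedge\dots)$ for an orthonormal basis $(e_j)$ of $V$ ($c\omega=0$ if $p=0$ or $q=0$); elements of $\ker c$ are called effective. When $2p\le n$ every element $\omega\in D^{p,p}$ can be written uniquely as $\sum_{i=0}^pg^{p-i}\omega_i$ with $\omega_i\in D^{i,i}$ effective. The Riemann curvature tensor $R\in D^{2,2}$ has the sign for which $R(x\wedge y,x\wedge y)$ is the sectional curvature for orthonormal $x,y$; $R^q\in D^{2q,2q}$. The sectional curvature of a symmetric $\omega\in D^{p,p}$ at a $p$-plane $P$ is $\omega(e_1\wedge\dots\wedge e_p,e_1\wedge\dots\wedge e_p)$ for an orthonormal basis of $P$. For $1\le q\le n/2$ and $0\le p\le n-2q$, the $(p,q)$-curvature $s_{(p,q)}(P)$ of a tangent $p$-plane $P$ is the sectional curvature of $\frac{1}{(n-2q-p)!}g^{n-2q-p}R^q$ at $P^\perp$. *)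

theory Defs
  imports "HOL-Analysis.Analysis"
begin

section \<open>Double forms on a real vector space\<close>

text \<open>
  A linear functional on the exterior power of degree p of V is the same thing as an alternating
  multilinear function of p vectors.  The vectors are passed as a list, and the function is required
  to vanish on lists of any other length, so that distinct functions are distinct forms.
\<close>

definition alternating_form :: "nat \<Rightarrow> ('v::real_vector list \<Rightarrow> real) \<Rightarrow> bool" where
  "alternating_form p \<theta> \<longleftrightarrow>
     (\<forall>xs. length xs \<noteq> p \<longrightarrow> \<theta> xs = 0) \<and>
     (\<forall>xs. \<forall>i<length xs. linear (\<lambda>v. \<theta> (xs[i := v]))) \<and>
     (\<forall>xs. \<not> distinct xs \<longrightarrow> \<theta> xs = 0)"

type_synonym 'v double_form = "'v list \<Rightarrow> 'v list \<Rightarrow> real"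

definition double_forms :: "nat \<Rightarrow> nat \<Rightarrow> 'v::real_vector double_form set" where
  "double_forms p q =
     {\<omega>. (\<forall>ys. alternating_form p (\<lambda>xs. \<omega> xs ys)) \<and> (\<forall>xs. alternating_form q (\<omega> xs))}"

text \<open>
  Wedge products are written as sums over shuffles: a subset A of the positions of a list selects the
  arguments of the first factor, its complement those of the second one, and \<open>shuffle_sign A\<close> is the
  sign of the permutation listing A in increasing order and then its complement.  With this
  normalisation wedges of distinct elements of a dual basis evaluate to 1 on the corresponding wedges
  of basis vectors.  Because forms vanish on lists of the wrong length, the degrees need not be
  mentioned: the terms with A of the wrong cardinality are zero.
\<close>

definition shuffle_sign :: "nat set \<Rightarrow> real" where
  "shuffle_sign A = (-1) ^ card {(i, j). i \<in> A \<and> j \<notin> A \<and> j < i}"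

definition wedge :: "('v list \<Rightarrow> real) \<Rightarrow> ('v list \<Rightarrow> real) \<Rightarrow> 'v list \<Rightarrow> real" where
  "wedge \<theta> \<eta> xs =
     (\<Sum>A\<in>Pow {..<length xs}. shuffle_sign A * \<theta> (nths xs A) * \<eta> (nths xs (- A)))"

definition df_mult :: "'v double_form \<Rightarrow> 'v double_form \<Rightarrow> 'v double_form" where
  "df_mult \<omega> \<eta> xs ys =
     (\<Sum>A\<in>Pow {..<length xs}. \<Sum>B\<in>Pow {..<length ys}.
        shuffle_sign A * shuffle_sign B *
        \<omega> (nths xs A) (nths ys B) * \<eta> (nths xs (- A)) (nths ys (- B)))"

definition df_tensor :: "('v list \<Rightarrow> real) \<Rightarrow> ('v list \<Rightarrow> real) \<Rightarrow> 'v double_form" where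
  "df_tensor \<theta> \<eta> xs ys = \<theta> xs * \<eta> ys"

text \<open>The defining property of the product of double forms.\<close>

lemma df_mult_tensor:
  "df_mult (df_tensor \<theta>1 \<theta>2) (df_tensor \<theta>3 \<theta>4) = df_tensor (wedge \<theta>1 \<theta>3) (wedge \<theta>2 \<theta>4)"
  by (intro ext) (simp add: df_mult_def df_tensor_def wedge_def sum_product mult_ac)

definition df_one :: "'v double_form" where
  "df_one xs ys = (if xs = [] \<and> ys = [] then 1 else 0)"

primrec df_power :: "'v double_form \<Rightarrow> nat \<Rightarrow> 'v double_form" where
  "df_power \<omega> 0 = df_one"
| "df_power \<omega> (Suc k) = df_mult \<omega> (df_power \<omega> k)"


section \<open>Inner products, contraction and sectional curvature\<close>

text \<open>
  Throughout, \<open>B\<close> is an inner product on \<open>'v\<close>; it need not be the one of the type class.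
\<close>

definition metric_form :: "('v \<Rightarrow> 'v \<Rightarrow> real) \<Rightarrow> 'v double_form" where
  "metric_form B xs ys =
     (if length xs = 1 \<and> length ys = 1 then B (xs ! 0) (ys ! 0) else 0)"

definition orthonormal_basis_of ::
    "('v::real_vector \<Rightarrow> 'v \<Rightarrow> real) \<Rightarrow> 'v set \<Rightarrow> 'v list \<Rightarrow> bool" where
  "orthonormal_basis_of B P es \<longleftrightarrow>
     span (set es) = P \<and>
     (\<forall>i<length es. \<forall>j<length es. B (es ! i) (es ! j) = (if i = j then 1 else 0))"

text \<open>
  The values of the next two notions do not depend on the orthonormal basis that is chosen.  On forms
  of bidegree (p, q) with p = 0 or q = 0 the contraction vanishes, since such a form is zero on a pair
  of nonempty lists.
\<close>

definition contraction ::
    "('v::real_vector \<Rightarrow> 'v \<Rightarrow> real) \<Rightarrow> 'v double_form \<Rightarrow> 'v double_form" where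
  "contraction B \<omega> xs ys =
     (let es = (SOME es. orthonormal_basis_of B UNIV es)
      in \<Sum>j<length es. \<omega> (es ! j # xs) (es ! j # ys))"

definition sectional_curvature ::
    "('v::real_vector \<Rightarrow> 'v \<Rightarrow> real) \<Rightarrow> 'v double_form \<Rightarrow> 'v set \<Rightarrow> real" where
  "sectional_curvature B \<omega> P =
     (let es = (SOME es. orthonormal_basis_of B P es) in \<omega> es es)"

definition effective_forms ::
    "('v::real_vector \<Rightarrow> 'v \<Rightarrow> real) \<Rightarrow> nat \<Rightarrow> nat \<Rightarrow> 'v double_form set" where
  "effective_forms B p q = {\<omega> \<in> double_forms p q. contraction B \<omega> = (\<lambda>xs ys. 0)}"

definition orth_compl :: "('v \<Rightarrow> 'v \<Rightarrow> real) \<Rightarrow> 'v set \<Rightarrow> 'v set" where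
  "orth_compl B P = {v. \<forall>w\<in>P. B v w = 0}"

text \<open>The family \<open>\<omega>\<close> is the decomposition of a form \<open>\<Omega>\<close> of bidegree (p, p).\<close>

definition effective_decomposition ::
    "('v::real_vector \<Rightarrow> 'v \<Rightarrow> real) \<Rightarrow> nat \<Rightarrow> 'v double_form \<Rightarrow> (nat \<Rightarrow> 'v double_form) \<Rightarrow> bool" where
  "effective_decomposition B p \<Omega> \<omega> \<longleftrightarrow>
     (\<forall>i\<le>p. \<omega> i \<in> effective_forms B i i) \<and>
     (\<forall>xs ys. \<Omega> xs ys = (\<Sum>i\<le>p. df_mult (df_power (metric_form B) (p - i)) (\<omega> i) xs ys))"

text \<open>The (p, q)-curvature, for a curvature tensor \<open>R\<close> on an inner product space.\<close>

definition pq_curvature ::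
    "('v::euclidean_space \<Rightarrow> 'v \<Rightarrow> real) \<Rightarrow> 'v double_form \<Rightarrow> nat \<Rightarrow> nat \<Rightarrow> 'v set \<Rightarrow> real" where
  "pq_curvature B R p q P =
     sectional_curvature B
       (\<lambda>xs ys. 1 / fact (DIM('v) - 2 * q - p) *
          df_mult (df_power (metric_form B) (DIM('v) - 2 * q - p)) (df_power R q) xs ys)
       (orth_compl B P)"


section \<open>Riemannian manifolds\<close>

text \<open>
  Manifolds are Hausdorff, second countable and nonempty, but not necessarily connected.  A chart is
  a pair of its domain and its coordinate map; values of the map outside the domain are irrelevant.
  The dimension is \<open>CARD('n)\<close>.
\<close>

definition partial_deriv :: "'n::finite \<Rightarrow> (real^'n \<Rightarrow> 'b::real_normed_vector) \<Rightarrow> real^'n \<Rightarrow> 'b" where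
  "partial_deriv i f x = frechet_derivative f (at x) (axis i 1)"

primrec Ck_on :: "nat \<Rightarrow> (real^'n::finite) set \<Rightarrow> (real^'n \<Rightarrow> 'b::real_normed_vector) \<Rightarrow> bool" where
  "Ck_on 0 S f \<longleftrightarrow> continuous_on S f"
| "Ck_on (Suc k) S f \<longleftrightarrow> f differentiable_on S \<and> (\<forall>i. Ck_on k S (partial_deriv i f))"

definition smooth_on_open :: "(real^'n::finite) set \<Rightarrow> (real^'n \<Rightarrow> 'b::real_normed_vector) \<Rightarrow> bool" where
  "smooth_on_open S f \<longleftrightarrow> open S \<and> (\<forall>k. Ck_on k S f)"

type_synonym ('a, 'n) chart = "'a set \<times> ('a \<Rightarrow> real^'n)"

definition is_chart :: "'a topology \<Rightarrow> ('a, 'n::finite) chart \<Rightarrow> bool" where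
  "is_chart X c \<longleftrightarrow> openin X (fst c) \<and> open (snd c ` fst c) \<and>
     homeomorphic_map (subtopology X (fst c)) (top_of_set (snd c ` fst c)) (snd c)"

definition transition :: "('a, 'n::finite) chart \<Rightarrow> ('a, 'n) chart \<Rightarrow> real^'n \<Rightarrow> real^'n" where
  "transition c d = snd d \<circ> inv_into (fst c) (snd c)"

definition smooth_manifold :: "'a topology \<Rightarrow> ('a, 'n::finite) chart set \<Rightarrow> bool" where
  "smooth_manifold X \<A> \<longleftrightarrow>
     topspace X \<noteq> {} \<and> Hausdorff_space X \<and> second_countable X \<and>
     (\<forall>c\<in>\<A>. is_chart X c) \<and> (\<Union>c\<in>\<A>. fst c) = topspace X \<and>
     (\<forall>c\<in>\<A>. \<forall>d\<in>\<A>. smooth_on_open (snd c ` (fst c \<inter> fst d)) (transition c d))"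

text \<open>
  The tangent space at a point m of the domain of a chart c is identified with \<open>real^'n\<close> by means of
  c; the differentials of the transition maps relate the identifications belonging to two charts
  around m.  A Riemannian metric is given by its Gram matrices \<open>G c x\<close> in each chart c, as functions
  of the coordinates x.
\<close>

type_synonym ('a, 'n) metric_tensor = "('a, 'n) chart \<Rightarrow> real^'n \<Rightarrow> real^'n^'n"

definition tangent_metric ::
    "('a, 'n::finite) metric_tensor \<Rightarrow> ('a, 'n) chart \<Rightarrow> 'a \<Rightarrow> real^'n \<Rightarrow> real^'n \<Rightarrow> real" where
  "tangent_metric G c m v w = v \<bullet> (G c (snd c m) *v w)"

definition riemannian_manifold ::
    "'a topology \<Rightarrow> ('a, 'n::finite) chart set \<Rightarrow> ('a, 'n) metric_tensor \<Rightarrow> bool" where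
  "riemannian_manifold X \<A> G \<longleftrightarrow>
     smooth_manifold X \<A> \<and>
     (\<forall>c\<in>\<A>. smooth_on_open (snd c ` fst c) (G c)) \<and>
     (\<forall>c\<in>\<A>. \<forall>m\<in>fst c.
        (\<forall>v w. tangent_metric G c m v w = tangent_metric G c m w v) \<and>
        (\<forall>v. v \<noteq> 0 \<longrightarrow> 0 < tangent_metric G c m v v)) \<and>
     (\<forall>c\<in>\<A>. \<forall>d\<in>\<A>. \<forall>m\<in>fst c \<inter> fst d. \<forall>v w.
        tangent_metric G c m v w =
        tangent_metric G d m
          (frechet_derivative (transition c d) (at (snd c m)) v)
          (frechet_derivative (transition c d) (at (snd c m)) w))"

text \<open>
  In the next three definitions \<open>g\<close> is the matrix of the metric in a fixed chart.  The index \<open>l\<close> of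
  \<open>christoffel g l i j\<close> is the upper one, and \<open>curvature_operator g x u v\<close> is the endomorphism
  R(u, v) given by the commutator of the covariant derivatives in the directions u and v
  (in this order) minus the covariant derivative along the bracket [u, v].
\<close>

definition christoffel ::
    "(real^'n::finite \<Rightarrow> real^'n^'n) \<Rightarrow> 'n \<Rightarrow> 'n \<Rightarrow> 'n \<Rightarrow> real^'n \<Rightarrow> real" where
  "christoffel g l i j x =
     1 / 2 * (\<Sum>k\<in>UNIV. matrix_inv (g x) $ l $ k *
       (partial_deriv i (\<lambda>y. g y $ j $ k) x + partial_deriv j (\<lambda>y. g y $ i $ k) x
        - partial_deriv k (\<lambda>y. g y $ i $ j) x))"

definition curvature_coeff ::
    "(real^'n::finite \<Rightarrow> real^'n^'n) \<Rightarrow> 'n \<Rightarrow> 'n \<Rightarrow> 'n \<Rightarrow> 'n \<Rightarrow> real^'n \<Rightarrow> real" where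
  "curvature_coeff g l k i j x =
     partial_deriv i (christoffel g l j k) x - partial_deriv j (christoffel g l i k) x
     + (\<Sum>a\<in>UNIV. christoffel g l i a x * christoffel g a j k x
                  - christoffel g l j a x * christoffel g a i k x)"

definition curvature_operator ::
    "(real^'n::finite \<Rightarrow> real^'n^'n) \<Rightarrow> real^'n \<Rightarrow> real^'n \<Rightarrow> real^'n \<Rightarrow> real^'n \<Rightarrow> real^'n" where
  "curvature_operator g x u v w =
     (\<chi> l. \<Sum>i\<in>UNIV. \<Sum>j\<in>UNIV. \<Sum>k\<in>UNIV. curvature_coeff g l k i j x * u $ i * v $ j * w $ k)"

text \<open>
  The value on (u wedge v, w wedge z) is \<open>\<langle>R(u, v) z, w\<rangle>\<close>, so that the value on
  (u wedge v, u wedge v) is the sectional curvature for orthonormal u, v.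
\<close>

definition riemann_tensor ::
    "('a, 'n::finite) metric_tensor \<Rightarrow> ('a, 'n) chart \<Rightarrow> 'a \<Rightarrow> (real^'n) double_form" where
  "riemann_tensor G c m xs ys =
     (if length xs = 2 \<and> length ys = 2
      then tangent_metric G c m
             (curvature_operator (G c) (snd c m) (xs ! 0) (xs ! 1) (ys ! 1)) (ys ! 0)
      else 0)"

definition tangent_perp ::
    "('a, 'n::finite) metric_tensor \<Rightarrow> ('a, 'n) chart \<Rightarrow> 'a \<Rightarrow> (real^'n) set \<Rightarrow> (real^'n) set" where
  "tangent_perp G c m = orth_compl (tangent_metric G c m)"

definition s_curvature ::
    "('a, 'n::finite) metric_tensor \<Rightarrow> nat \<Rightarrow> nat \<Rightarrow> ('a, 'n) chart \<Rightarrow> 'a \<Rightarrow> (real^'n) set \<Rightarrow> real" where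
  "s_curvature G p q c m P = pq_curvature (tangent_metric G c m) (riemann_tensor G c m) p q P"

text \<open>
  A tangent r-plane is a triple of a chart, a point of its domain and an r-dimensional subspace of
  the tangent space there, expressed in the chart.
\<close>

definition tangent_planes ::
    "('a, 'n::finite) chart set \<Rightarrow> nat \<Rightarrow> (('a, 'n) chart \<times> 'a \<times> (real^'n) set) set" where
  "tangent_planes \<A> r = {(c, m, P). c \<in> \<A> \<and> m \<in> fst c \<and> subspace P \<and> dim P = r}"

definition Rq_constant_sectional_curvature ::
    "('a, 'n::finite) chart set \<Rightarrow> ('a, 'n) metric_tensor \<Rightarrow> nat \<Rightarrow> bool" where
  "Rq_constant_sectional_curvature \<A> G q \<longleftrightarrow>
     (\<exists>\<kappa>. \<forall>(c, m, Q)\<in>tangent_planes \<A> (2 * q).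
        sectional_curvature (tangent_metric G c m) (df_power (riemann_tensor G c m) q) Q = \<kappa>)"

end

theory Submission
  imports Defs
begin

text \<open>
  Everything is read off orthonormal bases. For an effective form \<open>\<omega>\<close> of bidegree (i, i) and an
  orthonormal basis e, the function \<open>f(K) = \<omega>(e\<^sub>K, e\<^sub>K)\<close> of i-element sets K is harmonic: its sums over
  all one-element extensions of a fixed set vanish. The value of \<open>g\<^sup>k \<omega>\<close> at the plane spanned by
  \<open>e\<^sub>A\<close> is k! times the sum F(A) of f over the subsets of A, and harmonicity gives
  \<open>F(- A) = (-1)\<^sup>i F(A)\<close>. So both (p, q)-curvatures are linear combinations of the sums \<open>F\<^sub>i(A)\<close>
  belonging to the components of \<open>R\<^sup>q\<close>, with explicit coefficients. Harmonic functions of different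
  degrees can be separated, hence a combination is constant only if every component of positive
  degree with nonzero coefficient has vanishing sectional curvature. Since \<open>R\<^sup>q\<close> satisfies the first
  Bianchi identity, so do its components, and such a form vanishes together with its sectional
  curvature.
\<close>

section \<open>Wedge products and the first Bianchi identity\<close>

text \<open>Vanishing sectional curvature alone does not kill a component: a 4-form, read as an
  element of \<open>D^{2,2}\<close>, is effective and vanishes on every pair
  \<open>(x wedge y, x wedge y)\<close>. This is why the Bianchi identity has to be carried through
  products and down to the components. The bounds \<open>2 * q \<le> r\<close> and
  \<open>r + 2 * q \<le> n\<close> are what the separation of degrees needs: sums over r-element
  subsets of an n-element set determine a harmonic function whose degrees are at most 2q. The
  component of degree i enters with the coefficient \<open>(-1)^i * a i\<close> plus or minus
  \<open>b i\<close>, where \<open>a i = (n-r-i)!/(n-r-2q)!\<close> and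
  \<open>b i = (r-i)!/(r-2q)!\<close>. The sign appears because the (r,q)-curvature of P is
  evaluated on the complement of P. Since a and b are both 1 at i = 2q, the top component always
  cancels from the difference. Below the top they differ unless n = 2r, and in that case they
  coincide, so that the parity of i decides alone. This accounts for the four cases.\<close>

lemma finite_shuffle: "finite A \<Longrightarrow> finite {(i, j). i \<in> A \<and> j \<notin> A \<and> j < (i::nat)}"
  by (rule finite_subset[of _ "A \<times> (\<Union>i\<in>A. {..<i})"]) auto

text \<open>A new position 0 forms no inversion if it belongs to the set, and one with every shifted
  element if it does not.\<close>

lemma shuffle_sign_shift:
  assumes "finite A"
  shows "shuffle_sign (insert 0 (Suc ` A)) = shuffle_sign A"
    and "shuffle_sign (Suc ` A) = (-1) ^ card A * shuffle_sign A"
proof -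
  let ?I = "{(i, j). i \<in> A \<and> j \<notin> A \<and> j < (i::nat)}"
  have inj: "inj (map_prod Suc Suc)" by (simp add: prod.inj_map)
  have "{(i, j). i \<in> insert 0 (Suc ` A) \<and> j \<notin> insert 0 (Suc ` A) \<and> j < i} = map_prod Suc Suc ` ?I"
    (is "?L = ?R")
  proof (intro subset_antisym subsetI)
    fix x assume "x \<in> ?L"
    then obtain i j where ij: "x = (i, j)" "i \<in> insert 0 (Suc ` A)" "j \<notin> insert 0 (Suc ` A)" "j < i"
      by blast
    then obtain i' j' where "i = Suc i'" "j = Suc j'" by (metis insertI1 not0_implies_Suc not_less0)
    with ij have "(i', j') \<in> ?I" "x = map_prod Suc Suc (i', j')" by auto
    then show "x \<in> ?R" by blast
  qed auto
  then show "shuffle_sign (insert 0 (Suc ` A)) = shuffle_sign A"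
    unfolding shuffle_sign_def by (simp add: card_image[OF inj_on_subset[OF inj]])
  have "{(i, j). i \<in> Suc ` A \<and> j \<notin> Suc ` A \<and> j < i} = map_prod Suc Suc ` ?I \<union> (\<lambda>i. (Suc i, 0)) ` A"
    (is "?L = ?R")
  proof (intro subset_antisym subsetI)
    fix x assume "x \<in> ?L"
    then obtain i j where ij: "x = (i, j)" "i \<in> Suc ` A" "j \<notin> Suc ` A" "j < i"
      by blast
    then obtain i' where i': "i = Suc i'" "i' \<in> A" by auto
    show "x \<in> ?R"
    proof (cases j)
      case 0
      with ij i' show ?thesis by blast
    next
      case (Suc j')
      with ij i' have "(i', j') \<in> ?I" "x = map_prod Suc Suc (i', j')" by auto
      then show ?thesis by blast
    qed
  qed auto
  moreover have "card (map_prod Suc Suc ` ?I \<union> (\<lambda>i. (Suc i, 0)) ` A) = card ?I + card A"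
  proof (subst card_Un_disjoint)
    show "card (map_prod Suc Suc ` ?I) + card ((\<lambda>i. (Suc i, 0::nat)) ` A) = card ?I + card A"
      by (simp add: card_image inj_on_subset[OF inj] inj_on_def)
  qed (use assms finite_shuffle in auto)
  ultimately show "shuffle_sign (Suc ` A) = (-1) ^ card A * shuffle_sign A"
    unfolding shuffle_sign_def by (simp add: power_add)
qed

lemma shuffle_sign_insert_last:
  assumes "A \<subseteq> {..<m}"
  shows "shuffle_sign (insert m A) = (-1) ^ card ({..<m} - A) * shuffle_sign A"
proof -
  let ?I = "{(i, j). i \<in> A \<and> j \<notin> A \<and> j < (i::nat)}"
  have fin: "finite A" using assms finite_subset by blast
  have "{(i, j). i \<in> insert m A \<and> j \<notin> insert m A \<and> j < i} = ?I \<union> {m} \<times> ({..<m} - A)"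
    using assms by force
  moreover have "card (?I \<union> {m} \<times> ({..<m} - A)) = card ?I + card ({..<m} - A)"
    using assms by (subst card_Un_disjoint) (auto simp: fin finite_shuffle card_cartesian_product)
  ultimately show ?thesis unfolding shuffle_sign_def by (simp add: power_add)
qed

lemma sum_Pow_insert:
  assumes "finite S" "a \<notin> S"
  shows "(\<Sum>A\<in>Pow (insert a S). f A) = (\<Sum>A\<in>Pow S. f A) + (\<Sum>A\<in>Pow S. f (insert a A))"
proof -
  have "inj_on (insert a) (Pow S)" using assms(2) by (auto simp: inj_on_def)
  moreover have "Pow S \<inter> insert a ` Pow S = {}" using assms(2) by auto
  ultimately show ?thesis using assms(1)
    by (simp add: Pow_insert sum.union_disjoint sum.reindex)
qed

lemma length_nths_subset: "A \<subseteq> {..<length xs} \<Longrightarrow> length (nths xs A) = card A"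
  by (auto simp: length_nths intro!: arg_cong[where f = card])

section \<open>Recursion of the wedge product along the list of arguments\<close>

definition invol :: "('v list \<Rightarrow> real) \<Rightarrow> 'v list \<Rightarrow> real" where
  "invol \<theta> xs = (-1) ^ length xs * \<theta> xs"

lemma wedge_Nil [simp]: "wedge \<theta> \<eta> [] = \<theta> [] * \<eta> []"
  by (simp add: wedge_def shuffle_sign_def)

text \<open>Interior product with \<open>x\<close> is an antiderivation. \<open>invol\<close> is the
  grading involution of the exterior algebra and records the sign of moving \<open>x\<close> past
  the first factor. The list inductions below use this in place of the sum over shuffles.\<close>

lemma wedge_Cons:
  "wedge \<theta> \<eta> (x # xs) = wedge (\<lambda>a. \<theta> (x # a)) \<eta> xs + wedge (invol \<theta>) (\<lambda>a. \<eta> (x # a)) xs"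
proof -
  let ?n = "length xs" let ?t = "\<lambda>A. shuffle_sign A * \<theta> (nths (x#xs) A) * \<eta> (nths (x#xs) (- A))"
  have inj: "inj_on ((`) Suc) (Pow {..<?n})" by (auto simp: inj_on_def inj_image_eq_iff)
  have P: "Pow {..<length (x#xs)} = Pow (insert 0 (Suc ` {..<?n}))" by (simp add: lessThan_Suc_eq_insert_0)
  have S: "Pow (Suc ` {..<?n}) = (`) Suc ` Pow {..<?n}" by (simp add: image_Pow_surj)
  have "wedge \<theta> \<eta> (x # xs) = (\<Sum>A\<in>Pow (Suc ` {..<?n}). ?t A) + (\<Sum>A\<in>Pow (Suc ` {..<?n}). ?t (insert 0 A))"
    unfolding wedge_def P by (subst sum_Pow_insert) auto
  also have "(\<Sum>A\<in>Pow (Suc ` {..<?n}). ?t A) = (\<Sum>A\<in>Pow {..<?n}. ?t (Suc ` A))"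
    unfolding S by (simp add: sum.reindex[OF inj])
  also have "\<dots> = wedge (invol \<theta>) (\<lambda>a. \<eta> (x # a)) xs"
    unfolding wedge_def invol_def
  proof (rule sum.cong[OF refl], clarify)
    fix A assume A: "A \<subseteq> {..<?n}"
    have e: "{j. Suc j \<in> Suc ` A} = A" "{j. j \<notin> A} = - A" by auto
    show "?t (Suc ` A) = shuffle_sign A * ((-1) ^ length (nths xs A) * \<theta> (nths xs A)) * \<eta> (x # nths xs (- A))"
      using A finite_subset[OF A]
      by (simp add: nths_Cons e shuffle_sign_shift(2) length_nths_subset image_iff)
  qed
  also have "(\<Sum>A\<in>Pow (Suc ` {..<?n}). ?t (insert 0 A)) = (\<Sum>A\<in>Pow {..<?n}. ?t (insert 0 (Suc ` A)))"
    unfolding S by (simp add: sum.reindex[OF inj])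
  also have "\<dots> = wedge (\<lambda>a. \<theta> (x # a)) \<eta> xs"
    unfolding wedge_def
  proof (rule sum.cong[OF refl], clarify)
    fix A assume A: "A \<subseteq> {..<?n}"
    have e: "{j. Suc j \<in> insert 0 (Suc ` A)} = A" "{j. j \<notin> A} = - A" "{j. Suc j \<in> Suc ` A} = A" by auto
    show "?t (insert 0 (Suc ` A)) = shuffle_sign A * \<theta> (x # nths xs A) * \<eta> (nths xs (- A))"
      using A finite_subset[OF A]
      by (simp add: nths_Cons e inj_image_mem_iff shuffle_sign_shift(1))
  qed
  finally show ?thesis by simp
qed

text \<open>Now \<open>x\<close> enters from the right and has to pass the second factor, so the
  sign sits there. Needed because the Bianchi identity singles out the last entry of the second
  list.\<close>

lemma wedge_snoc:
  "wedge \<theta> \<eta> (xs @ [x]) = wedge \<theta> (\<lambda>a. \<eta> (a @ [x])) xs + wedge (\<lambda>a. \<theta> (a @ [x])) (invol \<eta>) xs"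
proof -
  let ?n = "length xs" let ?t = "\<lambda>A. shuffle_sign A * \<theta> (nths (xs@[x]) A) * \<eta> (nths (xs@[x]) (- A))"
  have P: "Pow {..<length (xs@[x])} = Pow (insert ?n {..<?n})" by (simp add: lessThan_Suc)
  have "wedge \<theta> \<eta> (xs @ [x]) = (\<Sum>A\<in>Pow {..<?n}. ?t A) + (\<Sum>A\<in>Pow {..<?n}. ?t (insert ?n A))"
    unfolding wedge_def P by (subst sum_Pow_insert) auto
  also have "(\<Sum>A\<in>Pow {..<?n}. ?t A) = wedge \<theta> (\<lambda>a. \<eta> (a @ [x])) xs"
    unfolding wedge_def
  proof (rule sum.cong[OF refl], clarify)
    fix A assume A: "A \<subseteq> {..<?n}"
    then have "?n \<notin> A" by auto
    then show "?t A = shuffle_sign A * \<theta> (nths xs A) * \<eta> (nths xs (- A) @ [x])"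
      by (simp add: nths_append)
  qed
  also have "(\<Sum>A\<in>Pow {..<?n}. ?t (insert ?n A)) = wedge (\<lambda>a. \<theta> (a @ [x])) (invol \<eta>) xs"
    unfolding wedge_def invol_def
  proof (rule sum.cong[OF refl], clarify)
    fix A assume A: "A \<subseteq> {..<?n}"
    have "nths xs (insert ?n A) = nths xs A" "nths xs (- insert ?n A) = nths xs (- A)"
      unfolding nths_def by (auto intro!: arg_cong[where f = "map fst"] filter_cong dest!: set_zip_rightD)
    moreover have "length (nths xs (- A)) = card ({..<?n} - A)"
      by (auto simp: length_nths intro!: arg_cong[where f = card])
    ultimately show "?t (insert ?n A) =
      shuffle_sign A * \<theta> (nths xs A @ [x]) * ((-1) ^ length (nths xs (- A)) * \<eta> (nths xs (- A)))"
      using A by (simp add: nths_append shuffle_sign_insert_last del: Compl_insert)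
  qed
  finally show ?thesis .
qed

lemma wedge_minus: "wedge (\<lambda>a. - \<theta> a) \<eta> xs = - wedge \<theta> \<eta> xs" "wedge \<theta> (\<lambda>a. - \<eta> a) xs = - wedge \<theta> \<eta> xs"
  by (simp_all add: wedge_def sum_negf)

lemma wedge_diff: "wedge (\<lambda>a. \<theta> a - \<theta>' a) \<eta> xs = wedge \<theta> \<eta> xs - wedge \<theta>' \<eta> xs"
  "wedge \<theta> (\<lambda>a. \<eta> a - \<eta>' a) xs = wedge \<theta> \<eta> xs - wedge \<theta> \<eta>' xs"
  by (simp_all add: wedge_def sum_subtractf algebra_simps)

lemma wedge_zero: "wedge (\<lambda>a. 0) \<eta> xs = 0" "wedge \<theta> (\<lambda>a. 0) xs = 0"
  by (simp_all add: wedge_def)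

lemma invol_invol [simp]: "invol (invol \<theta>) = \<theta>"
  by (simp add: invol_def fun_eq_iff)

lemma invol_Cons: "(\<lambda>a. invol \<theta> (x # a)) = (\<lambda>a. - invol (\<lambda>a. \<theta> (x # a)) a)"
  by (simp add: invol_def)

text \<open>Only neighbours are exchanged, and neither length nor linearity is mentioned. The
  property thus survives fixing leading or trailing arguments and can be proved for products by
  recursion on the list.\<close>

definition skew :: "('v list \<Rightarrow> real) \<Rightarrow> bool" where
  "skew \<theta> \<longleftrightarrow> (\<forall>us x y vs. \<theta> (us @ x # y # vs) = - \<theta> (us @ y # x # vs))"

lemma skewD: "skew \<theta> \<Longrightarrow> \<theta> (us @ x # y # vs) = - \<theta> (us @ y # x # vs)"
  unfolding skew_def by blast

lemma skewI: "(\<And>us x y vs. \<theta> (us @ x # y # vs) = - \<theta> (us @ y # x # vs)) \<Longrightarrow> skew \<theta>"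
  unfolding skew_def by blast

lemma skew_Cons: "skew \<theta> \<Longrightarrow> skew (\<lambda>a. \<theta> (x # a))"
proof (rule skewI)
  fix us a b vs assume "skew \<theta>"
  then show "\<theta> (x # us @ a # b # vs) = - \<theta> (x # us @ b # a # vs)" using skewD[of \<theta> "x # us" a b vs] by simp
qed

lemma skew_append: "skew \<theta> \<Longrightarrow> skew (\<lambda>a. \<theta> (a @ ws))"
proof (rule skewI)
  fix us a b vs assume "skew \<theta>"
  then show "\<theta> ((us @ a # b # vs) @ ws) = - \<theta> ((us @ b # a # vs) @ ws)" using skewD[of \<theta> us a b "vs @ ws"] by simp
qed

lemma skew_invol: "skew \<theta> \<Longrightarrow> skew (invol \<theta>)"
proof (rule skewI)
  fix us a b vs assume "skew \<theta>"
  from skewD[OF this, of us a b vs] show "invol \<theta> (us @ a # b # vs) = - invol \<theta> (us @ b # a # vs)"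
    unfolding invol_def by (simp only: mult_minus_right length_append length_Cons)
qed

lemma skew_wedge:
  assumes "skew \<theta>" "skew \<eta>"
  shows "skew (wedge \<theta> \<eta>)"
proof -
  have "wedge \<theta> \<eta> (us @ x # y # vs) = - wedge \<theta> \<eta> (us @ y # x # vs)" for us x y vs
    using assms
  proof (induction us arbitrary: \<theta> \<eta>)
    case Nil
    \<comment> \<open>Of the four terms of the expansion, the two with \<open>x\<close> and
      \<open>y\<close> in the same factor change sign by skewness. The two mixed ones are
      interchanged, and \<open>invol_Cons\<close> supplies their sign.\<close>
    have "(\<lambda>a. \<zeta> (x # y # a)) = (\<lambda>a. - \<zeta> (y # x # a))" if "skew \<zeta>" for \<zeta> :: "'a list \<Rightarrow> real"
      using skewD[OF that, of "[]" x y] by (intro ext) simp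
    note * = this[OF Nil(1)] this[OF Nil(2)]
    show ?case by (simp add: wedge_Cons invol_Cons wedge_minus *)
  next
    case (Cons u us)
    then show ?case by (simp add: wedge_Cons skew_Cons skew_invol)
  qed
  then show ?thesis unfolding skew_def by blast
qed

lemma skew_move:
  assumes "skew \<theta>"
  shows "\<theta> (us @ x # vs) = (-1) ^ length us * \<theta> (x # us @ vs)"
  using assms
proof (induction us arbitrary: \<theta>)
  case (Cons u us)
  then show ?case using Cons.IH[OF skew_Cons[OF Cons.prems], of u] skewD[OF Cons.prems, of "[]" u x]
    by simp
qed simp

lemma skew_not_distinct:
  assumes "skew \<theta>" "\<not> distinct xs"
  shows "\<theta> xs = 0"
proof -
  obtain us x vs ws where xs: "xs = us @ x # vs @ x # ws"
    using assms(2) not_distinct_decomp by (metis append_Cons append_Nil)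
  have "skew (\<lambda>a. \<theta> (us @ x # a))"
  proof (rule skewI)
    fix as a b bs
    show "\<theta> (us @ x # as @ a # b # bs) = - \<theta> (us @ x # as @ b # a # bs)"
      using skewD[OF assms(1), of "us @ x # as" a b bs] by simp
  qed
  from skew_move[OF this] have "\<theta> xs = (-1) ^ length vs * \<theta> (us @ x # x # vs @ ws)" by (simp add: xs)
  with skewD[OF assms(1), of us x x] show ?thesis by simp
qed

text \<open>The sign is chosen before the function, so that one and the same sign can be applied to
  both arguments of a double form.\<close>

lemma skew_perm:
  assumes "mset xs = mset ys"
  shows "\<exists>s. s * s = 1 \<and> (\<forall>\<theta> :: 'v list \<Rightarrow> real. skew \<theta> \<longrightarrow> \<theta> xs = s * \<theta> ys)"
  using assms
proof (induction xs arbitrary: ys)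
  case Nil
  then show ?case by (intro exI[of _ 1]) simp
next
  case (Cons x xs)
  then have "x \<in> set ys" by (metis list.set_intros(1) set_mset_mset)
  then obtain us vs where ys: "ys = us @ x # vs" by (meson split_list)
  with Cons.prems have "mset xs = mset (us @ vs)" by simp
  from Cons.IH[OF this] obtain s where s: "s * s = 1"
    and h: "\<And>\<theta> :: 'v list \<Rightarrow> real. skew \<theta> \<Longrightarrow> \<theta> xs = s * \<theta> (us @ vs)" by blast
  show ?case
  proof (intro exI[of _ "s * (-1) ^ length us"] conjI allI impI)
    show "s * (-1) ^ length us * (s * (-1) ^ length us) = 1"
    proof -
      have "s * (-1) ^ length us * (s * (-1) ^ length us) = (s * s) * ((-1) ^ length us * (-1) ^ length us)"
        by (simp only: ac_simps)
      then show ?thesis using s by (simp flip: power_add)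
    qed
    fix \<theta> :: "'v list \<Rightarrow> real" assume "skew \<theta>"
    then show "\<theta> (x # xs) = s * (-1) ^ length us * \<theta> ys"
      using h[OF skew_Cons] by (simp add: ys skew_move[of \<theta> us] algebra_simps flip: power_add)
  qed
qed

lemma df_mult_wedge_left:
  "df_mult \<omega> \<eta> xs ys = (\<Sum>B\<in>Pow {..<length ys}. shuffle_sign B *
     wedge (\<lambda>a. \<omega> a (nths ys B)) (\<lambda>a. \<eta> a (nths ys (- B))) xs)"
  unfolding df_mult_def wedge_def
  by (subst sum.swap) (simp add: sum_distrib_left mult_ac)

lemma df_mult_wedge_right:
  "df_mult \<omega> \<eta> xs ys = (\<Sum>A\<in>Pow {..<length xs}. shuffle_sign A *
     wedge (\<omega> (nths xs A)) (\<eta> (nths xs (- A))) ys)"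
  unfolding df_mult_def wedge_def by (simp add: sum_distrib_left mult_ac)

lemma df_mult_snoc:
  "df_mult \<omega> \<eta> xs (ys @ [v]) = df_mult \<omega> (\<lambda>a b. \<eta> a (b @ [v])) xs ys
     + df_mult (\<lambda>a b. \<omega> a (b @ [v])) (\<lambda>a. invol (\<eta> a)) xs ys"
  by (simp add: df_mult_wedge_right wedge_snoc sum.distrib algebra_simps)

lemma skew_sum: "(\<And>i. i \<in> I \<Longrightarrow> skew (f i)) \<Longrightarrow> skew (\<lambda>ys. \<Sum>i\<in>I. c i * f i ys)"
proof (rule skewI)
  fix us a b vs assume *: "\<And>i. i \<in> I \<Longrightarrow> skew (f i)"
  show "(\<Sum>i\<in>I. c i * f i (us @ a # b # vs)) = - (\<Sum>i\<in>I. c i * f i (us @ b # a # vs))"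
    unfolding sum_negf[symmetric]
  proof (rule sum.cong[OF refl])
    fix i assume "i \<in> I"
    then show "c i * f i (us @ a # b # vs) = - (c i * f i (us @ b # a # vs))"
      using skewD[OF *, of i us a b vs] by simp
  qed
qed

lemma skew_df_mult: "(\<And>xs. skew (\<omega> xs)) \<Longrightarrow> (\<And>xs. skew (\<eta> xs)) \<Longrightarrow> skew (df_mult \<omega> \<eta> xs)"
  unfolding df_mult_wedge_right[abs_def] by (intro skew_sum skew_wedge)

text \<open>The alternating sum, over the positions k of the list, of \<open>(-1)^k\<close> times
  \<phi> at the k-th entry and the list without it. With
  \<open>\<phi> v a = \<omega> a (ys @ [v])\<close> it is, up to sign, the Bianchi map from bidegree
  (p, q) to (p + 1, q - 1).\<close>

primrec bianchi_sum :: "('v \<Rightarrow> 'v list \<Rightarrow> real) \<Rightarrow> 'v list \<Rightarrow> real" where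
  "bianchi_sum \<phi> [] = 0"
| "bianchi_sum \<phi> (x # xs) = \<phi> x xs - bianchi_sum (\<lambda>v a. \<phi> v (x # a)) xs"

lemma bianchi_sum_zero [simp]: "bianchi_sum (\<lambda>v a. 0) xs = 0"
  by (induction xs) simp_all

text \<open>Every term splits one entry off \<open>xs\<close>. The multiset condition hands
  distinctness, lengths and orthonormality of \<open>xs\<close> over to the terms.\<close>

lemma bianchi_sum_cong:
  assumes "\<And>v a. mset (v # a) = mset xs \<Longrightarrow> \<phi> v a = \<psi> v a"
  shows "bianchi_sum \<phi> xs = bianchi_sum \<psi> xs"
  using assms
proof (induction xs arbitrary: \<phi> \<psi>)
  case (Cons x xs)
  have "bianchi_sum (\<lambda>v a. \<phi> v (x # a)) xs = bianchi_sum (\<lambda>v a. \<psi> v (x # a)) xs"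
    by (rule Cons.IH) (use Cons.prems in simp)
  then show ?case using Cons.prems by simp
qed simp

lemma bianchi_sum_lincomb:
  "bianchi_sum (\<lambda>v a. \<Sum>i\<in>I. c i * \<phi> i v a) xs = (\<Sum>i\<in>I. c i * bianchi_sum (\<phi> i) xs)"
  by (induction xs arbitrary: \<phi>) (simp_all add: sum_subtractf algebra_simps)

lemma bianchi_sum_add:
  "bianchi_sum (\<lambda>v a. \<phi> v a + \<psi> v a) xs = bianchi_sum \<phi> xs + bianchi_sum \<psi> xs"
  by (induction xs arbitrary: \<phi> \<psi>) simp_all

lemma bianchi_sum_minus: "bianchi_sum (\<lambda>v a. - \<phi> v a) xs = - bianchi_sum \<phi> xs"
  by (induction xs arbitrary: \<phi>) simp_all

text \<open>The terms of the sum are evaluated on lists shorter by one; hence the sign.\<close>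

lemma invol_bianchi_sum: "invol (bianchi_sum \<phi>) = (\<lambda>a. - bianchi_sum (\<lambda>v. invol (\<phi> v)) a)"
proof
  fix xs show "invol (bianchi_sum \<phi>) xs = - bianchi_sum (\<lambda>v. invol (\<phi> v)) xs"
  proof (induction xs arbitrary: \<phi>)
    case (Cons x xs)
    show ?case using Cons.IH[of "\<lambda>v a. \<phi> v (x # a)"]
      by (simp add: invol_def algebra_simps bianchi_sum_minus)
  qed (simp add: invol_def)
qed

text \<open>An instance of associativity of the exterior product, since \<open>bianchi_sum\<close>
  shuffles \<open>v\<close> into the remaining arguments. In the version for the second factor
  \<open>v\<close> first has to pass \<theta>, which turns \<theta> into
  \<open>invol \<theta>\<close>.\<close>

lemma bianchi_sum_wedge_left:
  "bianchi_sum (\<lambda>v. wedge (\<phi> v) \<eta>) xs = wedge (bianchi_sum \<phi>) \<eta> xs"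
proof (induction xs arbitrary: \<phi> \<eta>)
  case (Cons x xs)
  then show ?case
    by (simp add: wedge_Cons bianchi_sum_add wedge_diff invol_bianchi_sum wedge_minus)
qed simp

lemma bianchi_sum_wedge_right:
  "bianchi_sum (\<lambda>v. wedge \<theta> (\<psi> v)) xs = wedge (invol \<theta>) (bianchi_sum \<psi>) xs"
proof (induction xs arbitrary: \<theta> \<psi>)
  case (Cons x xs)
  then show ?case
    by (simp add: wedge_Cons bianchi_sum_add wedge_diff invol_Cons wedge_minus)
qed simp

text \<open>The first Bianchi identity; the distinguished argument is put at the end of the second list,
  where the identity holds for \<open>riemann_tensor\<close> without using that the connection is metric.\<close>

definition bianchi :: "'v double_form \<Rightarrow> bool" where
  "bianchi \<omega> \<longleftrightarrow> (\<forall>xs ys. bianchi_sum (\<lambda>v a. \<omega> a (ys @ [v])) xs = 0)"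

text \<open>The vector at the end of the second list is passed to one of the two factors. In either
  case the alternating sum reduces to the Bianchi sum of that factor, which vanishes.\<close>

lemma bianchi_df_mult:
  assumes "bianchi \<omega>" "bianchi \<eta>"
  shows "bianchi (df_mult \<omega> \<eta>)"
  unfolding bianchi_def
proof (intro allI)
  fix xs ys
  have z: "bianchi_sum (\<lambda>v a. \<omega> a (ys @ [v])) = (\<lambda>_. 0)" "bianchi_sum (\<lambda>v a. \<eta> a (ys @ [v])) = (\<lambda>_. 0)" for ys
    using assms by (auto simp: bianchi_def)
  let ?l = "\<lambda>B v. wedge (\<lambda>a. \<omega> a (nths ys B)) (\<lambda>a. \<eta> a (nths ys (- B) @ [v]))"
  let ?r = "\<lambda>B v. wedge (\<lambda>a. \<omega> a (nths ys B @ [v])) (\<lambda>a. (-1) ^ length (nths ys (- B)) * \<eta> a (nths ys (- B)))"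
  have "bianchi_sum (\<lambda>v a. df_mult \<omega> \<eta> a (ys @ [v])) xs =
     (\<Sum>B\<in>Pow {..<length ys}. shuffle_sign B * bianchi_sum (?l B) xs)
     + (\<Sum>B\<in>Pow {..<length ys}. shuffle_sign B * bianchi_sum (?r B) xs)"
    unfolding df_mult_snoc bianchi_sum_add unfolding df_mult_wedge_left invol_def
      bianchi_sum_lincomb[of shuffle_sign "\<lambda>B v a. ?l B v a"]
      bianchi_sum_lincomb[of shuffle_sign "\<lambda>B v a. ?r B v a"] ..
  then show "bianchi_sum (\<lambda>v a. df_mult \<omega> \<eta> a (ys @ [v])) xs = 0"
    by (simp add: bianchi_sum_wedge_left bianchi_sum_wedge_right z wedge_zero)
qed

lemma bianchi_df_power: "bianchi \<omega> \<Longrightarrow> bianchi (df_power \<omega> k)"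
proof (induction k)
  case 0
  show ?case by (simp add: bianchi_def df_one_def)
qed (simp add: bianchi_df_mult)

text \<open>Meant for a block \<open>A\<close> that also occurs in the second list: splitting an
  entry of \<open>A\<close> off the first list would repeat it in the second, so such terms
  vanish.\<close>

lemma bianchi_sum_append:
  assumes "\<And>v a. v \<in> set A \<Longrightarrow> \<phi> v a = 0"
  shows "bianchi_sum \<phi> (A @ X) = (-1) ^ length A * bianchi_sum (\<lambda>v a. \<phi> v (A @ a)) X"
  using assms by (induction A arbitrary: \<phi>) simp_all


section \<open>Harmonic functions on subsets\<close>

lemma sum_Pow_remove:
  assumes "finite A" "a \<in> A"
  shows "(\<Sum>K\<in>Pow A. g K) = (\<Sum>K\<in>Pow (A - {a}). g K) + (\<Sum>K\<in>Pow (A - {a}). g (insert a K))"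
  using sum_Pow_insert[of "A - {a}" a g] assms by (simp add: insert_absorb)

text \<open>Double counting of the pairs of a subset and one of its elements. For f concentrated in
  a single degree the left side is that degree times the sum of f; \<open>sum_Pow_card'\<close>
  groups the same pairs by the set without the element.\<close>

lemma sum_Pow_card:
  fixes f :: "'a set \<Rightarrow> real"
  assumes "finite A"
  shows "(\<Sum>K\<in>Pow A. real (card K) * f K) = (\<Sum>a\<in>A. \<Sum>K\<in>Pow (A - {a}). f (insert a K))"
proof -
  have "(\<Sum>K\<in>Pow A. real (card K) * f K) = (\<Sum>K\<in>Pow A. \<Sum>a\<in>A. if a \<in> K then f K else 0)"
  proof (rule sum.cong[OF refl])
    fix K assume "K \<in> Pow A"
    then have "A \<inter> K = K" by auto
    then show "real (card K) * f K = (\<Sum>a\<in>A. if a \<in> K then f K else 0)"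
      using assms by (simp add: sum.If_cases Collect_mem_eq)
  qed
  also have "\<dots> = (\<Sum>a\<in>A. \<Sum>K\<in>Pow A. if a \<in> K then f K else 0)" by (rule sum.swap)
  also have "\<dots> = (\<Sum>a\<in>A. \<Sum>K\<in>Pow (A - {a}). f (insert a K))"
  proof (rule sum.cong[OF refl])
    fix a assume "a \<in> A"
    have "(\<Sum>K\<in>Pow (A - {a}). if a \<in> K then f K else 0) = 0" by (intro sum.neutral) auto
    then show "(\<Sum>K\<in>Pow A. if a \<in> K then f K else 0) = (\<Sum>K\<in>Pow (A - {a}). f (insert a K))"
      using sum_Pow_remove[OF assms \<open>a \<in> A\<close>, of "\<lambda>K. if a \<in> K then f K else 0"] by simp
  qed
  finally show ?thesis .
qed

lemma sum_Pow_card':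
  fixes f :: "'a set \<Rightarrow> real"
  assumes "finite A"
  shows "(\<Sum>K\<in>Pow A. real (card K) * f K) = (\<Sum>K\<in>Pow A. \<Sum>a\<in>A - K. f (insert a K))"
proof -
  have "(\<Sum>K\<in>Pow A. \<Sum>a\<in>A - K. f (insert a K)) = (\<Sum>K\<in>Pow A. \<Sum>a\<in>A. if a \<notin> K then f (insert a K) else 0)"
  proof (rule sum.cong[OF refl])
    fix K
    show "(\<Sum>a\<in>A - K. f (insert a K)) = (\<Sum>a\<in>A. if a \<notin> K then f (insert a K) else 0)"
      using assms by (intro sum.mono_neutral_cong_left) auto
  qed
  also have "\<dots> = (\<Sum>a\<in>A. \<Sum>K\<in>Pow A. if a \<notin> K then f (insert a K) else 0)" by (rule sum.swap)
  also have "\<dots> = (\<Sum>a\<in>A. \<Sum>K\<in>Pow (A - {a}). f (insert a K))"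
  proof (rule sum.cong[OF refl])
    fix a assume "a \<in> A"
    have "(\<Sum>K\<in>Pow (A - {a}). if a \<notin> K then f (insert a K) else 0) = (\<Sum>K\<in>Pow (A - {a}). f (insert a K))"
      by (intro sum.cong) auto
    then show "(\<Sum>K\<in>Pow A. if a \<notin> K then f (insert a K) else 0) = (\<Sum>K\<in>Pow (A - {a}). f (insert a K))"
      using sum_Pow_remove[OF assms \<open>a \<in> A\<close>, of "\<lambda>K. if a \<notin> K then f (insert a K) else 0"] by simp
  qed
  finally show ?thesis using sum_Pow_card[OF assms, of f] by simp
qed

text \<open>Modelled on \<open>K \<mapsto> \<omega>(e\<^sub>K, e\<^sub>K)\<close> for an effective form: the condition is the vanishing of the
  contraction.\<close>

definition harmonic :: "'a set \<Rightarrow> ('a set \<Rightarrow> real) \<Rightarrow> bool" where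
  "harmonic U f \<longleftrightarrow> (\<forall>K\<subseteq>U. (\<Sum>j\<in>U - K. f (insert j K)) = 0)"

text \<open>Fixing an element lowers the degree by one; inductions on the degree rest on
  this.\<close>

lemma harmonic_insert:
  assumes "harmonic U f" "a \<in> U"
  shows "harmonic (U - {a}) (\<lambda>K. f (insert a K))"
  unfolding harmonic_def
proof (intro allI impI)
  fix K assume K: "K \<subseteq> U - {a}"
  have "(\<Sum>j\<in>U - insert a K. f (insert j (insert a K))) = 0"
    using assms K unfolding harmonic_def by blast
  moreover have "U - {a} - K = U - insert a K" by auto
  ultimately show "(\<Sum>j\<in>U - {a} - K. f (insert a (insert j K))) = 0" by (simp add: insert_commute)
qed

text \<open>Induction on the degree. The degree times the sum over subsets of \<open>A\<close> is a
  sum over a in \<open>A\<close> and K in \<open>A - {a}\<close>. The induction hypothesis on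
  \<open>U - {a}\<close> moves K into \<open>U - A\<close>, and harmonicity then replaces the sum
  over a in \<open>A\<close> by minus the sum over a in \<open>U - A - K\<close>. This is the degree
  times the sum over subsets of \<open>U - A\<close>, with one more sign.\<close>

lemma harmonic_sum_compl:
  assumes "finite U" "harmonic U f" "\<And>K. K \<subseteq> U \<Longrightarrow> card K \<noteq> d \<Longrightarrow> f K = 0" "A \<subseteq> U"
  shows "(\<Sum>K\<in>Pow (U - A). f K) = (-1) ^ d * (\<Sum>K\<in>Pow A. f K)"
  using assms
proof (induction d arbitrary: U f A)
  case 0
  have *: "(\<Sum>K\<in>Pow S. f K) = f {}" if "S \<subseteq> U" for S
  proof -
    have "finite S" using that 0(1) finite_subset by blast
    then have "(\<Sum>K\<in>Pow S. f K) = (\<Sum>K\<in>{{}}. f K)"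
      using that 0(1,3) by (intro sum.mono_neutral_right) (auto simp: card_eq_0_iff dest: finite_subset)
    then show ?thesis by simp
  qed
  show ?case using *[of A] *[of "U - A"] 0(4) by auto
next
  case (Suc d)
  have fin: "finite A" "finite (U - A)" using Suc.prems(1,4) finite_subset by auto
  have deg: "real (card K) * f K = real (Suc d) * f K" if "K \<subseteq> U" for K
    using Suc.prems(3)[OF that] by (cases "card K = Suc d") auto
  have degsum: "(\<Sum>K\<in>Pow S. real (card K) * f K) = real (Suc d) * (\<Sum>K\<in>Pow S. f K)" if "S \<subseteq> U" for S
    unfolding sum_distrib_left using that by (intro sum.cong refl deg) auto
  have step: "(\<Sum>K\<in>Pow (A - {a}). f (insert a K)) = (-1) ^ d * (\<Sum>K\<in>Pow (U - A). f (insert a K))"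
    if a: "a \<in> A" for a
  proof -
    have "(\<Sum>K\<in>Pow (U - {a} - (A - {a})). f (insert a K)) = (-1) ^ d * (\<Sum>K\<in>Pow (A - {a}). f (insert a K))"
    proof (rule Suc.IH)
      show "finite (U - {a})" "A - {a} \<subseteq> U - {a}" using Suc.prems(1,4) by auto
      show "harmonic (U - {a}) (\<lambda>K. f (insert a K))" using Suc.prems(2,4) a by (intro harmonic_insert) auto
      fix K assume K: "K \<subseteq> U - {a}" "card K \<noteq> d"
      then have "finite K" "a \<notin> K" using Suc.prems(1) finite_subset by blast+
      then have "card (insert a K) \<noteq> Suc d" using K by simp
      moreover have "insert a K \<subseteq> U" using K a Suc.prems(4) by blast
      ultimately show "f (insert a K) = 0" by (rule Suc.prems(3)[rotated])
    qed
    moreover have "U - {a} - (A - {a}) = U - A" using a by auto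
    ultimately show ?thesis by (cases "even d") auto
  qed
  have "real (Suc d) * (\<Sum>K\<in>Pow A. f K) = (\<Sum>a\<in>A. \<Sum>K\<in>Pow (A - {a}). f (insert a K))"
    using degsum[OF Suc.prems(4)] sum_Pow_card[OF fin(1), of f] by simp
  also have "\<dots> = (-1) ^ d * (\<Sum>a\<in>A. \<Sum>K\<in>Pow (U - A). f (insert a K))"
    by (simp add: step sum_distrib_left)
  also have "(\<Sum>a\<in>A. \<Sum>K\<in>Pow (U - A). f (insert a K)) = (\<Sum>K\<in>Pow (U - A). \<Sum>a\<in>A. f (insert a K))"
    by (rule sum.swap)
  also have "\<dots> = (\<Sum>K\<in>Pow (U - A). - (\<Sum>a\<in>U - A - K. f (insert a K)))"
  proof (rule sum.cong[OF refl])
    fix K assume K: "K \<in> Pow (U - A)"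
    have "U - K = A \<union> (U - A - K)" using K Suc.prems(4) by auto
    moreover have "(\<Sum>a\<in>A \<union> (U - A - K). f (insert a K)) = (\<Sum>a\<in>A. f (insert a K)) + (\<Sum>a\<in>U - A - K. f (insert a K))"
      using fin by (intro sum.union_disjoint) auto
    moreover have "(\<Sum>a\<in>U - K. f (insert a K)) = 0"
      using Suc.prems(2) K unfolding harmonic_def by auto
    ultimately show "(\<Sum>a\<in>A. f (insert a K)) = - (\<Sum>a\<in>U - A - K. f (insert a K))" by simp
  qed
  also have "\<dots> = - (real (Suc d) * (\<Sum>K\<in>Pow (U - A). f K))"
    using degsum[of "U - A"] sum_Pow_card'[OF fin(2), of f] by (simp add: sum_negf)
  finally have "real (Suc d) * (\<Sum>K\<in>Pow A. f K) = real (Suc d) * ((-1) ^ Suc d * (\<Sum>K\<in>Pow (U - A). f K))"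
    by simp
  then have "(\<Sum>K\<in>Pow A. f K) = (-1) ^ Suc d * (\<Sum>K\<in>Pow (U - A). f K)"
    by (subst (asm) mult_left_cancel) auto
  then show ?case by (cases "even d") auto
qed

text \<open>The differences \<open>f (insert a K) - f (insert b K)\<close> satisfy the same hypotheses on \<open>U - {a, b}\<close> with
  smaller degree, so they vanish by induction; then all terms of each harmonicity relation agree.\<close>

lemma harmonic_eq_zero:
  assumes "finite U" "harmonic U f" "\<And>K. K \<subseteq> U \<Longrightarrow> card K > p \<Longrightarrow> f K = 0"
    and "p \<le> r" "r + p \<le> card U"
    and "\<And>A. A \<subseteq> U \<Longrightarrow> card A = r \<Longrightarrow> (\<Sum>K\<in>Pow A. f K) = 0"
    and "K \<subseteq> U"
  shows "f K = 0"
proof -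
  \<comment> \<open>Harmonicity says nothing about the value at the empty set. Once all other values
    are known to vanish, a single r-element set yields it.\<close>
  have empty: "f {} = 0" if "finite U" "\<And>K. K \<subseteq> U \<Longrightarrow> K \<noteq> {} \<Longrightarrow> f K = 0" "r \<le> card U"
     "\<And>A. A \<subseteq> U \<Longrightarrow> card A = r \<Longrightarrow> (\<Sum>K\<in>Pow A. f K) = 0" for U r and f :: "'a set \<Rightarrow> real"
  proof -
    have "\<exists>A. A \<subseteq> U \<and> card A = r" using that(3) by (meson obtain_subset_with_card_n)
    then obtain A where A: "A \<subseteq> U" "card A = r" by blast
    then have "(\<Sum>K\<in>Pow A. f K) = (\<Sum>K\<in>{{}}. f K)"
      using that(1,2) by (intro sum.mono_neutral_right) (auto dest: finite_subset)
    with that(4)[OF A] show ?thesis by simp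
  qed
  show ?thesis
    using assms
  proof (induction p arbitrary: U r f K)
    case 0
    have *: "f K = 0" if "K \<subseteq> U" "K \<noteq> {}" for K
      using that 0(1,3) by (auto simp: card_gt_0_iff dest: finite_subset)
    moreover have "f {} = 0" by (rule empty[OF 0(1) _ _ 0(6)]) (use * 0(5) in auto)
    ultimately show ?case using 0(7) by blast
  next
    case (Suc p)
    have swap: "f (insert a K) = f (insert b K)" if ab: "a \<in> U" "b \<in> U" "a \<noteq> b" and K: "K \<subseteq> U - {a, b}" for a b K
    proof -
      have "f (insert a K) - f (insert b K) = 0"
      proof (rule Suc.IH[where U = "U - {a, b}" and r = "r - 1" and f = "\<lambda>K. f (insert a K) - f (insert b K)" and K = K])
        show "finite (U - {a, b})" using Suc.prems(1) by auto
        have e: "U - {a, b} = U - {a} - {b}" "U - {a, b} = U - {b} - {a}" by auto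
        show "harmonic (U - {a, b}) (\<lambda>K. f (insert a K) - f (insert b K))"
          unfolding harmonic_def
        proof (intro allI impI)
          fix K assume K: "K \<subseteq> U - {a, b}"
          have r: "U - {a} - K = insert b (U - {a, b} - K)" "U - {b} - K = insert a (U - {a, b} - K)"
            using ab K by auto
          have "(\<Sum>j\<in>insert b (U - {a, b} - K). f (insert a (insert j K))) = 0"
            "(\<Sum>j\<in>insert a (U - {a, b} - K). f (insert b (insert j K))) = 0"
            using harmonic_insert[OF Suc.prems(2) ab(1)] harmonic_insert[OF Suc.prems(2) ab(2)] K
            unfolding harmonic_def r[symmetric] by blast+
          then show "(\<Sum>j\<in>U - {a, b} - K. f (insert a (insert j K)) - f (insert b (insert j K))) = 0"
            using Suc.prems(1) by (simp add: sum_subtractf insert_commute)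
        qed
        show "f (insert a K) - f (insert b K) = 0" if "K \<subseteq> U - {a, b}" "p < card K" for K
        proof -
          have "finite K" "a \<notin> K" "b \<notin> K" using that(1) Suc.prems(1) finite_subset by blast+
          then have "card (insert a K) > Suc p" "card (insert b K) > Suc p" using that by auto
          moreover have "insert a K \<subseteq> U" "insert b K \<subseteq> U" using that ab by auto
          ultimately have "f (insert a K) = 0" "f (insert b K) = 0" using Suc.prems(3) by blast+
          then show ?thesis by simp
        qed
        \<comment> \<open>Passing to differences uses up one element of each r-set and two elements
          of \<open>U\<close>, so both bounds persist with \<open>Suc p\<close> lowered to
          \<open>p\<close>.\<close>
        show "p \<le> r - 1" "r - 1 + p \<le> card (U - {a, b})" using Suc.prems(1,4,5) ab by (auto simp: card_Diff_subset)
        \<comment> \<open>Subtract the relations for \<open>insert a A\<close> and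
          \<open>insert b A\<close>: the subsets of \<open>A\<close> itself contribute equally to
          both.\<close>
        show "(\<Sum>K\<in>Pow A. f (insert a K) - f (insert b K)) = 0" if "A \<subseteq> U - {a, b}" "card A = r - 1" for A
        proof -
          have A: "finite A" "a \<notin> A" "b \<notin> A" using that(1) Suc.prems(1) finite_subset by blast+
          then have "card (insert a A) = r" "card (insert b A) = r" using that Suc.prems(4) by auto
          moreover have "insert a A \<subseteq> U" "insert b A \<subseteq> U" using that(1) ab by auto
          ultimately have "(\<Sum>K\<in>Pow (insert a A). f K) = 0" "(\<Sum>K\<in>Pow (insert b A). f K) = 0"
            using Suc.prems(6) by blast+
          then show ?thesis using A by (simp add: sum_Pow_insert sum_subtractf)
        qed
      qed (use K in auto)
      then show ?thesis by simp
    qed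
    have *: "f K = 0" if K: "K \<subseteq> U" "K \<noteq> {}" for K
    proof -
      obtain k where k: "k \<in> K" using K by blast
      define K' where "K' = K - {k}"
      have K': "K = insert k K'" "K' \<subseteq> U" "k \<in> U - K'" using K k unfolding K'_def by auto
      have "0 = (\<Sum>j\<in>U - K'. f (insert j K'))" using Suc.prems(2) K'(2) unfolding harmonic_def by auto
      also have "\<dots> = (\<Sum>j\<in>U - K'. f K)"
      proof (rule sum.cong[OF refl])
        fix j assume j: "j \<in> U - K'"
        show "f (insert j K') = f K"
        proof (cases "j = k")
          case False
          have "K' \<subseteq> U - {j, k}" using j K'(2,3) by auto
          with swap[of j k K'] False j K'(3) have "f (insert j K') = f (insert k K')" by auto
          then show ?thesis using K'(1) by simp
        qed (use K' in auto)
      qed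
      also have "\<dots> = card (U - K') * f K" by simp
      finally show ?thesis using K'(3) Suc.prems(1) by (auto simp: card_eq_0_iff)
    qed
    moreover have "f {} = 0" by (rule empty[OF Suc.prems(1) _ _ Suc.prems(6)]) (use * Suc.prems(5) in auto)
    ultimately show ?case using Suc.prems(7) by blast
  qed
qed

text \<open>An i-element subset of \<open>A\<close> lies in exactly
  \<open>(card A - i) choose (m - i)\<close> of the m-element subsets.\<close>

lemma sum_subsets_of_subsets:
  fixes f :: "'a set \<Rightarrow> real"
  assumes "finite A" "\<And>I. I \<subseteq> A \<Longrightarrow> card I \<noteq> i \<Longrightarrow> f I = 0" "i \<le> m"
  shows "(\<Sum>K\<in>{K \<in> Pow A. card K = m}. \<Sum>I\<in>Pow K. f I) = real ((card A - i) choose (m - i)) * (\<Sum>I\<in>Pow A. f I)"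
proof -
  let ?P = "{K \<in> Pow A. card K = m}"
  have "(\<Sum>K\<in>?P. \<Sum>I\<in>Pow K. f I) = (\<Sum>K\<in>?P. \<Sum>I\<in>Pow A. if I \<subseteq> K then f I else 0)"
    using assms(1) by (intro sum.cong sum.mono_neutral_cong_left) auto
  also have "\<dots> = (\<Sum>I\<in>Pow A. \<Sum>K\<in>?P. if I \<subseteq> K then f I else 0)" by (rule sum.swap)
  also have "\<dots> = (\<Sum>I\<in>Pow A. real ((card A - i) choose (m - i)) * f I)"
  proof (rule sum.cong[OF refl])
    fix I assume I: "I \<in> Pow A"
    show "(\<Sum>K\<in>?P. if I \<subseteq> K then f I else 0) = real ((card A - i) choose (m - i)) * f I"
    proof (cases "card I = i")
      case True
      have fin: "finite I" using I assms(1) finite_subset by auto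
      have "bij_betw (\<lambda>L. L \<union> I) {L. L \<subseteq> A - I \<and> card L = m - i} {K \<in> ?P. I \<subseteq> K}"
      proof (rule bij_betw_byWitness[where f' = "\<lambda>K. K - I"])
        show "(\<lambda>L. L \<union> I) ` {L. L \<subseteq> A - I \<and> card L = m - i} \<subseteq> {K \<in> ?P. I \<subseteq> K}"
        proof (rule image_subsetI)
          fix L assume "L \<in> {L. L \<subseteq> A - I \<and> card L = m - i}"
          then have L: "L \<subseteq> A - I" "card L = m - i" by auto
          then have "finite L" using assms(1) finite_subset by blast
          then have "card (L \<union> I) = card L + card I" using L fin by (intro card_Un_disjoint) auto
          then show "L \<union> I \<in> {K \<in> ?P. I \<subseteq> K}" using L I True assms(3) by auto
        qed
        show "(\<lambda>K. K - I) ` {K \<in> ?P. I \<subseteq> K} \<subseteq> {L. L \<subseteq> A - I \<and> card L = m - i}"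
          using True fin by (auto simp: card_Diff_subset)
      qed auto
      from bij_betw_same_card[OF this] have "card {K \<in> ?P. I \<subseteq> K} = card (A - I) choose (m - i)"
        using n_subsets[of "A - I" "m - i"] assms(1) by simp
      moreover have "card (A - I) = card A - i" using True fin I by (simp add: card_Diff_subset)
      moreover have "(\<Sum>K\<in>?P. if I \<subseteq> K then f I else 0) = (\<Sum>K\<in>{K \<in> ?P. I \<subseteq> K}. f I)"
        using assms(1) by (intro sum.inter_filter[symmetric]) auto
      ultimately show ?thesis by simp
    next
      case False
      with assms(2) I have "f I = 0" by blast
      moreover from this have "(\<Sum>K\<in>?P. if I \<subseteq> K then f I else 0) = 0" by (intro sum.neutral) auto
      ultimately show ?thesis by simp
    qed
  qed
  finally show ?thesis by (simp add: sum_distrib_left)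
qed


section \<open>Products with powers of the metric on orthonormal lists\<close>

definition dskew :: "'v double_form \<Rightarrow> bool" where
  "dskew \<omega> \<longleftrightarrow> (\<forall>ys. skew (\<lambda>xs. \<omega> xs ys)) \<and> (\<forall>xs. skew (\<omega> xs))"

lemma dskew_not_distinct:
  assumes "dskew \<omega>" "\<not> distinct xs \<or> \<not> distinct ys"
  shows "\<omega> xs ys = 0"
  using assms skew_not_distinct[of "\<lambda>xs. \<omega> xs ys" xs] skew_not_distinct[of "\<omega> xs" ys]
  unfolding dskew_def by blast

lemma dskew_df_mult:
  assumes "dskew \<omega>" "dskew \<eta>"
  shows "dskew (df_mult \<omega> \<eta>)"
  unfolding dskew_def
proof (intro conjI allI)
  show "skew (df_mult \<omega> \<eta> xs)" for xs using assms by (intro skew_df_mult) (auto simp: dskew_def)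
  show "skew (\<lambda>xs. df_mult \<omega> \<eta> xs ys)" for ys
    unfolding df_mult_wedge_left using assms by (intro skew_sum skew_wedge) (auto simp: dskew_def)
qed

lemma dskew_metric_power: "dskew (df_power (metric_form B) k)"
proof (induction k)
  case 0
  then show ?case by (simp add: dskew_def skew_def df_one_def)
next
  case (Suc k)
  have "dskew (metric_form B)" by (simp add: dskew_def skew_def metric_form_def)
  then show ?case using Suc by (simp add: dskew_df_mult)
qed

text \<open>The same permutation acts on both lists, so its sign enters squared.\<close>

lemma dskew_perm:
  assumes "dskew \<omega>" "mset l = mset l'"
  shows "\<omega> (l @ X) (l @ Y) = \<omega> (l' @ X) (l' @ Y)"
proof -
  obtain s where s: "s * s = 1" "\<And>\<theta> :: 'a list \<Rightarrow> real. skew \<theta> \<Longrightarrow> \<theta> l = s * \<theta> l'"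
    using skew_perm[OF assms(2)] by blast
  have "skew (\<lambda>a. \<omega> (a @ X) (l @ Y))" "skew (\<lambda>a. \<omega> (l' @ X) (a @ Y))"
    using assms(1) skew_append[of "\<lambda>a. \<omega> a (l @ Y)" X] skew_append[of "\<omega> (l' @ X)" Y] unfolding dskew_def by auto
  note * = s(2)[OF this(1)] s(2)[OF this(2)]
  have "\<omega> (l @ X) (l @ Y) = (s * s) * \<omega> (l' @ X) (l' @ Y)" unfolding * mult.assoc ..
  then show ?thesis by (simp add: s)
qed

text \<open>Phrased through the set of entries, so that the property passes at once to any distinct
  list drawn from it; repetitions, invisible to the set, are excluded separately.\<close>

definition orthonormal :: "('v \<Rightarrow> 'v \<Rightarrow> real) \<Rightarrow> 'v list \<Rightarrow> bool" where
  "orthonormal B es \<longleftrightarrow> distinct es \<and> (\<forall>x\<in>set es. \<forall>y\<in>set es. B x y = (if x = y then 1 else 0))"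

lemma orthonormal_nth:
  "orthonormal B es \<longleftrightarrow> (\<forall>i<length es. \<forall>j<length es. B (es ! i) (es ! j) = (if i = j then 1 else 0))"
proof
  assume "orthonormal B es"
  then show "\<forall>i<length es. \<forall>j<length es. B (es ! i) (es ! j) = (if i = j then 1 else 0)"
    by (auto simp: orthonormal_def nth_eq_iff_index_eq)
next
  assume *: "\<forall>i<length es. \<forall>j<length es. B (es ! i) (es ! j) = (if i = j then 1 else 0)"
  have "distinct es" unfolding distinct_conv_nth
  proof (intro allI impI)
    fix i j assume "i < length es" "j < length es" "i \<noteq> j"
    then have "B (es ! i) (es ! j) = 0" "B (es ! j) (es ! j) = 1" using * by auto
    then show "es ! i \<noteq> es ! j" by auto
  qed
  then show "orthonormal B es" using * unfolding orthonormal_def by (auto simp: in_set_conv_nth nth_eq_iff_index_eq)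
qed

lemma orthonormal_mono:
  "orthonormal B es \<Longrightarrow> distinct fs \<Longrightarrow> set fs \<subseteq> set es \<Longrightarrow> orthonormal B fs"
  unfolding orthonormal_def by blast

text \<open>The vanishing property that the powers of the metric share.\<close>

definition pairing_form :: "('v \<Rightarrow> 'v \<Rightarrow> real) \<Rightarrow> 'v double_form \<Rightarrow> bool" where
  "pairing_form B \<eta> \<longleftrightarrow> (\<forall>xs ys. (\<exists>x\<in>set xs. \<forall>y\<in>set ys. B x y = 0) \<or> (\<exists>y\<in>set ys. \<forall>x\<in>set xs. B x y = 0) \<longrightarrow> \<eta> xs ys = 0)"

lemma pairing_formD:
  assumes "pairing_form B \<eta>"
  shows "x \<in> set xs \<Longrightarrow> (\<And>y. y \<in> set ys \<Longrightarrow> B x y = 0) \<Longrightarrow> \<eta> xs ys = 0"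
    and "y \<in> set ys \<Longrightarrow> (\<And>x. x \<in> set xs \<Longrightarrow> B x y = 0) \<Longrightarrow> \<eta> xs ys = 0"
  using assms unfolding pairing_form_def by blast+

lemma pairing_form_metric: "pairing_form B (metric_form B)"
  unfolding pairing_form_def metric_form_def by (auto simp: length_Suc_conv)

lemma in_set_nths_cases: "x \<in> set xs \<Longrightarrow> x \<in> set (nths xs A) \<or> x \<in> set (nths xs (- A))"
proof -
  assume "x \<in> set xs"
  then obtain i where "x = xs ! i" "i < length xs" by (metis in_set_conv_nth)
  then show ?thesis by (cases "i \<in> A") (auto simp: set_nths)
qed

lemma pairing_form_df_mult:
  assumes "pairing_form B \<omega>" "pairing_form B \<eta>"
  shows "pairing_form B (df_mult \<omega> \<eta>)"
  unfolding pairing_form_def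
proof (intro allI impI)
  fix xs ys assume h: "(\<exists>x\<in>set xs. \<forall>y\<in>set ys. B x y = 0) \<or> (\<exists>y\<in>set ys. \<forall>x\<in>set xs. B x y = 0)"
  have "\<omega> (nths xs S) (nths ys T) = 0 \<or> \<eta> (nths xs (- S)) (nths ys (- T)) = 0" for S T
    using h
  proof
    assume "\<exists>x\<in>set xs. \<forall>y\<in>set ys. B x y = 0"
    then obtain x where x: "x \<in> set xs" "\<And>y. y \<in> set ys \<Longrightarrow> B x y = 0" by blast
    from in_set_nths_cases[OF x(1), of S] show ?thesis
    proof
      assume "x \<in> set (nths xs S)"
      then have "\<omega> (nths xs S) (nths ys T) = 0"
        by (rule pairing_formD(1)[OF assms(1)]) (use x(2) in \<open>blast dest: in_set_nthsD\<close>)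
      then show ?thesis ..
    next
      assume "x \<in> set (nths xs (- S))"
      then have "\<eta> (nths xs (- S)) (nths ys (- T)) = 0"
        by (rule pairing_formD(1)[OF assms(2)]) (use x(2) in \<open>blast dest: in_set_nthsD\<close>)
      then show ?thesis ..
    qed
  next
    assume "\<exists>y\<in>set ys. \<forall>x\<in>set xs. B x y = 0"
    then obtain x where x: "x \<in> set ys" "\<And>y. y \<in> set xs \<Longrightarrow> B y x = 0" by blast
    from in_set_nths_cases[OF x(1), of T] show ?thesis
    proof
      assume "x \<in> set (nths ys T)"
      then have "\<omega> (nths xs S) (nths ys T) = 0"
        by (rule pairing_formD(2)[OF assms(1)]) (use x(2) in \<open>blast dest: in_set_nthsD\<close>)
      then show ?thesis ..
    next
      assume "x \<in> set (nths ys (- T))"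
      then have "\<eta> (nths xs (- S)) (nths ys (- T)) = 0"
        by (rule pairing_formD(2)[OF assms(2)]) (use x(2) in \<open>blast dest: in_set_nthsD\<close>)
      then show ?thesis ..
    qed
  qed
  then show "df_mult \<omega> \<eta> xs ys = 0" unfolding df_mult_def by (auto intro!: sum.neutral)
qed

lemma pairing_form_power: "pairing_form B (df_power (metric_form B) k)"
proof (induction k)
  case 0
  then show ?case by (auto simp: pairing_form_def df_one_def)
qed (simp add: pairing_form_df_mult pairing_form_metric)

lemma nths_append_left:
  assumes "S \<subseteq> {..<length A}"
  shows "nths (A @ X) S = nths A S" "nths (A @ X) (- S) = nths A (- S) @ X"
proof -
  have "{j. j + length A \<in> S} = {}" "{j. j + length A \<notin> S} = UNIV" using assms by auto
  then show "nths (A @ X) S = nths A S" "nths (A @ X) (- S) = nths A (- S) @ X"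
    by (auto simp: nths_append nths_all)
qed

text \<open>If \<eta> is nonzero on the selected vectors, each of them pairs nontrivially with one
  on the other side and, by orthonormality, equals it. Equal vectors occur only in \<open>A\<close>
  and at the same position, so both selections agree and lie in \<open>A\<close>; the shuffle sign
  is squared.\<close>

lemma df_mult_pairing:
  assumes \<eta>: "pairing_form B \<eta>" and o: "orthonormal B (A @ X @ Y)"
  shows "df_mult \<eta> \<omega> (A @ X) (A @ Y) =
    (\<Sum>S\<in>Pow {..<length A}. \<eta> (nths A S) (nths A S) * \<omega> (nths A (- S) @ X) (nths A (- S) @ Y))"
proof -
  let ?P = "\<lambda>X. Pow {..<length (A @ X)}"
  define t where "t = (\<lambda>S T. shuffle_sign S * shuffle_sign T * \<eta> (nths (A @ X) S) (nths (A @ Y) T) *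
     \<omega> (nths (A @ X) (- S)) (nths (A @ Y) (- T)))"
  have D: "distinct (A @ X @ Y)" using o by (simp add: orthonormal_def)
  have B0: "B x y = 0" if "x \<in> set (A @ X)" "y \<in> set (A @ Y)" "x \<noteq> y" for x y
    using that o unfolding orthonormal_def by force
  have common: "i < length A \<and> i \<in> T"
    if "i < length (A @ X)" "T \<subseteq> {..<length (A @ Y)}" "(A @ X) ! i \<in> set (nths (A @ Y) T)"
      "set X \<inter> set Y = {}" "distinct (A @ X)" "distinct (A @ Y)" for i T and X Y :: "'a list"
  proof -
    have "\<exists>j. (A @ X) ! i = (A @ Y) ! j \<and> j < length (A @ Y) \<and> j \<in> T"
      using that(3) by (auto simp: set_nths)
    then obtain j where j: "(A @ X) ! i = (A @ Y) ! j" "j < length (A @ Y)" "j \<in> T" by blast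
    then have "(A @ X) ! i \<in> set (A @ X) \<inter> set (A @ Y)" using that(1) by (metis IntI nth_mem)
    then have "(A @ X) ! i \<in> set A" using that(4) by auto
    then obtain k where k: "k < length A" "(A @ X) ! i = A ! k" by (metis in_set_conv_nth)
    then have "(A @ X) ! i = (A @ X) ! k" "(A @ Y) ! j = (A @ Y) ! k" using j by (auto simp: nth_append)
    then have "i = k" "j = k"
      using nth_eq_iff_index_eq[OF that(5), of i k] nth_eq_iff_index_eq[OF that(6), of j k] that(1) j(2) k(1) by auto
    then show ?thesis using k j by simp
  qed
  have zero: "t S T = 0" if S: "S \<in> ?P X" and T: "T \<in> ?P Y" and ne: "S \<noteq> T \<or> \<not> S \<subseteq> {..<length A}" for S T
  proof (rule ccontr)
    assume "t S T \<noteq> 0"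
    then have nz: "\<eta> (nths (A @ X) S) (nths (A @ Y) T) \<noteq> 0" unfolding t_def by auto
    have "i < length A \<and> i \<in> T" if "i \<in> S" for i
    proof -
      have i: "i < length (A @ X)" using that S by auto
      then have "(A @ X) ! i \<in> set (nths (A @ X) S)" using that by (auto simp only: set_nths)
      then obtain y where "y \<in> set (nths (A @ Y) T)" "B ((A @ X) ! i) y \<noteq> 0"
        using nz pairing_formD(1)[OF \<eta>] by blast
      then have "(A @ X) ! i \<in> set (nths (A @ Y) T)" using B0 i by (metis in_set_nthsD nth_mem)
      then show ?thesis using common[of i X T Y] i T D by auto
    qed
    moreover have "i < length A \<and> i \<in> S" if "i \<in> T" for i
    proof -
      have i: "i < length (A @ Y)" using that T by auto
      then have "(A @ Y) ! i \<in> set (nths (A @ Y) T)" using that by (auto simp only: set_nths)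
      then obtain y where "y \<in> set (nths (A @ X) S)" "B y ((A @ Y) ! i) \<noteq> 0"
        using nz pairing_formD(2)[OF \<eta>] by blast
      then have "(A @ Y) ! i \<in> set (nths (A @ X) S)" using B0 i by (metis in_set_nthsD nth_mem)
      then show ?thesis using common[of i Y S X] i S D by auto
    qed
    ultimately show False using ne by blast
  qed
  have "df_mult \<eta> \<omega> (A @ X) (A @ Y) = (\<Sum>S\<in>?P X. \<Sum>T\<in>?P Y. t S T)"
    unfolding df_mult_def t_def by simp
  also have "\<dots> = (\<Sum>S\<in>?P X. if S \<subseteq> {..<length A} then t S S else 0)"
  proof (rule sum.cong[OF refl])
    fix S assume S: "S \<in> ?P X"
    show "(\<Sum>T\<in>?P Y. t S T) = (if S \<subseteq> {..<length A} then t S S else 0)"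
    proof (cases "S \<subseteq> {..<length A}")
      case True
      then have "S \<in> ?P Y" by auto
      then have "(\<Sum>T\<in>?P Y. t S T) = (\<Sum>T\<in>{S}. t S T)"
        using zero[OF S] by (intro sum.mono_neutral_right) auto
      then show ?thesis using True by simp
    next
      case False
      then show ?thesis using zero[OF S] by (auto intro!: sum.neutral)
    qed
  qed
  also have "\<dots> = (\<Sum>S\<in>Pow {..<length A}. t S S)"
    by (rule sum.mono_neutral_cong_right) auto
  also have "\<dots> = (\<Sum>S\<in>Pow {..<length A}. \<eta> (nths A S) (nths A S) * \<omega> (nths A (- S) @ X) (nths A (- S) @ Y))"
  proof (rule sum.cong[OF refl])
    fix S assume "S \<in> Pow {..<length A}"
    moreover have "shuffle_sign S * shuffle_sign S = 1" unfolding shuffle_sign_def by (simp flip: power_add)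
    ultimately show "t S S = \<eta> (nths A S) (nths A S) * \<omega> (nths A (- S) @ X) (nths A (- S) @ Y)"
      unfolding t_def by (simp add: nths_append_left)
  qed
  finally show ?thesis .
qed

lemma length_nths_compl: "S \<subseteq> {..<length xs} \<Longrightarrow> length (nths xs (- S)) = length xs - card S"
proof -
  assume S: "S \<subseteq> {..<length xs}"
  have "length (nths xs (- S)) = card ({..<length xs} - S)"
    by (auto simp: length_nths intro!: arg_cong[where f = card])
  then show ?thesis using S by (simp add: card_Diff_subset finite_subset)
qed

lemma orthonormal_nths: "orthonormal B A \<Longrightarrow> orthonormal B (nths A S)"
  by (rule orthonormal_mono) (auto simp: orthonormal_def distinct_nthsI dest: in_set_nthsD)

text \<open>On orthonormal lists of length k this is k! times a Gram determinant equal to 1. In the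
  recursion the first factor can take any one of the \<open>Suc k\<close> vectors.\<close>

lemma df_power_metric_diag:
  assumes "orthonormal B A"
  shows "df_power (metric_form B) k A A = (if length A = k then fact k else 0)"
  using assms
proof (induction k arbitrary: A)
  case 0
  then show ?case by (simp add: df_one_def)
next
  case (Suc k)
  have "df_power (metric_form B) (Suc k) A A = (\<Sum>S\<in>Pow {..<length A}.
     metric_form B (nths A S) (nths A S) * df_power (metric_form B) k (nths A (- S)) (nths A (- S)))"
    using df_mult_pairing[OF pairing_form_metric[of B], of A "[]" "[]"] Suc.prems by simp
  also have "\<dots> = (\<Sum>S\<in>Pow {..<length A}. if card S = 1 then (if length A = Suc k then fact k else 0) else 0)"
  proof (rule sum.cong[OF refl])
    fix S assume S: "S \<in> Pow {..<length A}"
    show "metric_form B (nths A S) (nths A S) * df_power (metric_form B) k (nths A (- S)) (nths A (- S)) =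
      (if card S = 1 then (if length A = Suc k then fact k else 0) else 0)"
    proof (cases "card S = 1")
      case True
      then have l: "length (nths A S) = 1" using S by (simp add: length_nths_subset)
      \<comment> \<open>For \<open>k = 0\<close> truncated subtraction would let an empty
        \<open>A\<close> pass as a list of length 1.\<close>
      have "S \<noteq> {}" using True by auto
      then have "length A > 0" using S by auto
      then have "(length A - 1 = k) = (length A = Suc k)" by auto
      then have "df_power (metric_form B) k (nths A (- S)) (nths A (- S)) = (if length A = Suc k then fact k else 0)"
        using Suc.IH[OF orthonormal_nths[OF Suc.prems]] S True by (simp add: length_nths_compl)
      moreover have "metric_form B (nths A S) (nths A S) = 1"
        using l orthonormal_nths[OF Suc.prems, of S] by (simp add: metric_form_def orthonormal_nth)
      ultimately show ?thesis using True by simp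
    next
      case False
      then show ?thesis using S by (simp add: metric_form_def length_nths_subset)
    qed
  qed
  also have "\<dots> = (\<Sum>S\<in>{S. S \<subseteq> {..<length A} \<and> card S = 1}. if length A = Suc k then fact k else 0)"
    by (intro sum.mono_neutral_cong_right) auto
  also have "\<dots> = (if length A = Suc k then fact (Suc k) else 0)"
    using n_subsets[of "{..<length A}" 1] by simp
  finally show ?case .
qed

definition list_of :: "'a set \<Rightarrow> 'a list" where
  "list_of K = (SOME l. distinct l \<and> set l = K)"

lemma list_of:
  assumes "finite K"
  shows "distinct (list_of K)" "set (list_of K) = K"
  using someI_ex[of "\<lambda>l. distinct l \<and> set l = K"] finite_distinct_list[OF assms] unfolding list_of_def by blast+

lemma length_list_of: "finite K \<Longrightarrow> length (list_of K) = card K"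
  using list_of distinct_card by metis

text \<open>By skew symmetry in both arguments the value does not depend on the enumeration \<open>list_of K\<close>.\<close>

definition diag_value :: "'v double_form \<Rightarrow> 'v list \<Rightarrow> 'v list \<Rightarrow> 'v set \<Rightarrow> real" where
  "diag_value \<omega> X Y K = \<omega> (list_of K @ X) (list_of K @ Y)"

lemma diag_value_eq:
  assumes "dskew \<omega>" "distinct l"
  shows "\<omega> (l @ X) (l @ Y) = diag_value \<omega> X Y (set l)"
proof -
  have "mset l = mset (list_of (set l))"
    using list_of[of "set l"] assms(2) by (simp add: set_eq_iff_mset_eq_distinct)
  then show ?thesis unfolding diag_value_def by (rule dskew_perm[OF assms(1)])
qed

text \<open>The metric power takes k vectors of the common block \<open>A\<close> and leaves a set K
  to \<omega>. The parts \<open>X\<close> and \<open>Y\<close>, in which the arguments differ, go to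
  \<omega> entirely.\<close>

lemma df_mult_metric_power:
  assumes o: "orthonormal B (A @ X @ Y)" and \<omega>: "dskew \<omega>"
  shows "df_mult (df_power (metric_form B) k) \<omega> (A @ X) (A @ Y) =
    fact k * (\<Sum>K\<in>{K \<in> Pow (set A). card K + k = length A}. diag_value \<omega> X Y K)"
proof -
  have oA: "orthonormal B A" and dA: "distinct A" using o orthonormal_mono[OF o, of A] by (auto simp: orthonormal_def)
  let ?h = "\<lambda>S. (!) A ` ({..<length A} - S)"
  have h: "set (nths A (- S)) = ?h S" for S by (auto simp: set_nths)
  have inj: "inj_on ((!) A) {..<length A}" using dA by (simp add: inj_on_nth)
  have "df_mult (df_power (metric_form B) k) \<omega> (A @ X) (A @ Y) =
    (\<Sum>S\<in>Pow {..<length A}. df_power (metric_form B) k (nths A S) (nths A S) * \<omega> (nths A (- S) @ X) (nths A (- S) @ Y))"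
    by (rule df_mult_pairing[OF pairing_form_power o])
  also have "\<dots> = (\<Sum>S\<in>{S \<in> Pow {..<length A}. card S = k}. fact k * diag_value \<omega> X Y (?h S))"
  proof (rule sum.mono_neutral_cong_right)
    show "\<forall>S\<in>Pow {..<length A} - {S \<in> Pow {..<length A}. card S = k}.
      df_power (metric_form B) k (nths A S) (nths A S) * \<omega> (nths A (- S) @ X) (nths A (- S) @ Y) = 0"
      by (auto simp: df_power_metric_diag orthonormal_nths oA length_nths_subset)
    fix S assume "S \<in> {S \<in> Pow {..<length A}. card S = k}"
    then show "df_power (metric_form B) k (nths A S) (nths A S) * \<omega> (nths A (- S) @ X) (nths A (- S) @ Y)
       = fact k * diag_value \<omega> X Y (?h S)"
      using diag_value_eq[OF \<omega>, of "nths A (- S)"] dA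
      by (simp add: df_power_metric_diag orthonormal_nths oA length_nths_subset distinct_nthsI h)
  qed auto
  also have "\<dots> = fact k * (\<Sum>S\<in>{S \<in> Pow {..<length A}. card S = k}. diag_value \<omega> X Y (?h S))"
    by (simp add: sum_distrib_left)
  also have "(\<Sum>S\<in>{S \<in> Pow {..<length A}. card S = k}. diag_value \<omega> X Y (?h S)) =
     (\<Sum>K\<in>{K \<in> Pow (set A). card K + k = length A}. diag_value \<omega> X Y K)"
  \<comment> \<open>Position sets given to the metric power correspond to the sets of vectors left
    over.\<close>
  proof (rule sum.reindex_bij_betw, rule bij_betw_byWitness[where f' = "\<lambda>K. {i. i < length A \<and> A ! i \<notin> K}"])
    show "\<forall>S\<in>{S \<in> Pow {..<length A}. card S = k}. {i. i < length A \<and> A ! i \<notin> ?h S} = S"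
      using inj by (auto simp: inj_on_def)
    show hinv: "\<forall>K\<in>{K \<in> Pow (set A). card K + k = length A}. ?h {i. i < length A \<and> A ! i \<notin> K} = K"
    proof
      fix K assume "K \<in> {K \<in> Pow (set A). card K + k = length A}"
      then have "K \<subseteq> (!) A ` {..<length A}" by (auto simp: set_conv_nth)
      moreover have "{..<length A} - {i. i < length A \<and> A ! i \<notin> K} = {..<length A} \<inter> (!) A -` K" by auto
      ultimately show "?h {i. i < length A \<and> A ! i \<notin> K} = K" by auto
    qed
    have card: "card (?h S) + card S = length A" if "S \<subseteq> {..<length A}" for S
    proof -
      have "card (?h S) = card ({..<length A} - S)" by (intro card_image inj_on_subset[OF inj]) auto
      then show ?thesis using that card_mono[OF _ that] by (simp add: card_Diff_subset finite_subset)
    qed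
    show "?h ` {S \<in> Pow {..<length A}. card S = k} \<subseteq> {K \<in> Pow (set A). card K + k = length A}"
      using card by auto
    show "(\<lambda>K. {i. i < length A \<and> A ! i \<notin> K}) ` {K \<in> Pow (set A). card K + k = length A}
        \<subseteq> {S \<in> Pow {..<length A}. card S = k}"
    proof (rule image_subsetI)
      fix K assume K: "K \<in> {K \<in> Pow (set A). card K + k = length A}"
      let ?S = "{i. i < length A \<and> A ! i \<notin> K}"
      have "?S \<subseteq> {..<length A}" by auto
      from card[OF this] have "card K + card ?S = length A" using hinv K by simp
      with K show "?S \<in> {S \<in> Pow {..<length A}. card S = k}" by auto
    qed
  qed
  finally show ?thesis .
qed

text \<open>The restriction on the size of K is absorbed by the vanishing of \<omega> in other
  degrees. All components of a decomposition are thereby summed over the same power set.\<close>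

lemma df_mult_metric_power_degree:
  assumes o: "orthonormal B (A @ X @ Y)" and \<omega>: "dskew \<omega>"
    and deg: "\<And>xs ys. length xs \<noteq> i \<Longrightarrow> \<omega> xs ys = 0" and p: "length A + length X = p" "i \<le> p"
  shows "df_mult (df_power (metric_form B) (p - i)) \<omega> (A @ X) (A @ Y) =
    fact (p - i) * (\<Sum>K\<in>Pow (set A). diag_value \<omega> X Y K)"
proof -
  have "diag_value \<omega> X Y K = 0" if "K \<in> Pow (set A)" "card K + (p - i) \<noteq> length A" for K
  proof -
    have "finite K" using that(1) finite_subset by auto
    then have "length (list_of K @ X) \<noteq> i" using that p by (auto simp: length_list_of)
    then show ?thesis unfolding diag_value_def by (rule deg)
  qed
  then have "(\<Sum>K\<in>{K \<in> Pow (set A). card K + (p - i) = length A}. diag_value \<omega> X Y K) = (\<Sum>K\<in>Pow (set A). diag_value \<omega> X Y K)"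
    by (intro sum.mono_neutral_left) auto
  then show ?thesis by (simp add: df_mult_metric_power[OF o \<omega>])
qed


section \<open>Effective forms on an inner product space\<close>

lemma alternating_form_linear:
  assumes "alternating_form p \<theta>"
  shows "linear (\<lambda>v. \<theta> (us @ v # vs))"
proof -
  have "\<forall>xs. \<forall>i<length xs. linear (\<lambda>v. \<theta> (xs[i := v]))"
    using assms unfolding alternating_form_def by blast
  from this[rule_format, of "length us" "us @ undefined # vs"] show ?thesis by simp
qed

text \<open>Polarisation of the vanishing on a repeated vector \<open>x + y\<close>.\<close>

lemma alternating_form_skew:
  assumes "alternating_form p \<theta>"
  shows "skew \<theta>"
proof (rule skewI)
  fix us x y vs
  note lin1 = alternating_form_linear[OF assms, of us]
  have lin2: "linear (\<lambda>v. \<theta> (us @ w # v # vs))" for w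
    using alternating_form_linear[OF assms, of "us @ [w]" vs] by simp
  have nd: "\<theta> (us @ w # w # vs) = 0" for w using assms unfolding alternating_form_def by auto
  have "\<theta> (us @ (x + y) # (x + y) # vs) =
     \<theta> (us @ x # x # vs) + \<theta> (us @ x # y # vs) + \<theta> (us @ y # x # vs) + \<theta> (us @ y # y # vs)"
    by (simp add: linear_add[OF lin1] linear_add[OF lin2])
  then show "\<theta> (us @ x # y # vs) = - \<theta> (us @ y # x # vs)" by (simp add: nd)
qed

text \<open>Entries are replaced from the left end onward in the reduction: the suffix
  \<open>ys\<close> already lies in \<open>S\<close>, and linearity in the entry before it extends
  the vanishing from \<open>S\<close> to its span.\<close>

lemma alternating_form_eq_0:
  assumes \<theta>: "alternating_form p \<theta>" and S: "span S = UNIV"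
    and z: "\<And>xs. set xs \<subseteq> S \<Longrightarrow> \<theta> xs = 0"
  shows "\<theta> xs = 0"
proof -
  have "\<theta> (xs @ ys) = 0" if "set ys \<subseteq> S" for ys
    using that
  proof (induction xs arbitrary: ys rule: rev_induct)
    case Nil
    then show ?case using z by simp
  next
    case (snoc x xs)
    have "\<theta> (xs @ v # ys) = 0" if "v \<in> S" for v using snoc.IH[of "v # ys"] snoc.prems that by simp
    then have "\<theta> (xs @ x # ys) = 0"
      using linear_eq_0_on_span[OF alternating_form_linear[OF \<theta>, of xs ys], of S x] S by simp
    then show ?case by simp
  qed
  from this[of "[]"] show ?thesis by simp
qed

lemma double_formsD:
  assumes "\<omega> \<in> double_forms p q"
  shows "dskew \<omega>" "length xs \<noteq> p \<Longrightarrow> \<omega> xs ys = 0" "length ys \<noteq> q \<Longrightarrow> \<omega> xs ys = 0"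
    "linear (\<lambda>v. \<omega> (us @ v # vs) ys)" "linear (\<lambda>v. \<omega> xs (us @ v # vs))"
proof -
  have a: "alternating_form p (\<lambda>xs. \<omega> xs ys)" "alternating_form q (\<omega> xs)" for xs ys
    using assms unfolding double_forms_def by auto
  show "dskew \<omega>" unfolding dskew_def using a alternating_form_skew by blast
  show "length xs \<noteq> p \<Longrightarrow> \<omega> xs ys = 0" "length ys \<noteq> q \<Longrightarrow> \<omega> xs ys = 0"
    using a unfolding alternating_form_def by auto
  show "linear (\<lambda>v. \<omega> (us @ v # vs) ys)" "linear (\<lambda>v. \<omega> xs (us @ v # vs))"
    using alternating_form_linear[OF a(1)] alternating_form_linear[OF a(2)] .
qed

lemma double_form_eq_0:
  assumes \<omega>: "\<omega> \<in> double_forms p q" and S: "span S = UNIV"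
    and z: "\<And>xs ys. set xs \<subseteq> S \<Longrightarrow> set ys \<subseteq> S \<Longrightarrow> \<omega> xs ys = 0"
  shows "\<omega> = (\<lambda>xs ys. 0)"
proof (intro ext)
  fix xs ys
  have a: "alternating_form p (\<lambda>xs. \<omega> xs ys)" "alternating_form q (\<omega> xs)" for xs ys
    using \<omega> unfolding double_forms_def by auto
  show "\<omega> xs ys = 0"
    by (rule alternating_form_eq_0[OF a(1) S], rule alternating_form_eq_0[OF a(2) S]) (rule z)
qed

text \<open>Moving the split-off entry back to its place undoes the alternating sign, so all terms
  equal \<open>\<theta> xs\<close>.\<close>

lemma bianchi_sum_skew:
  fixes \<theta> :: "'v list \<Rightarrow> real"
  assumes "skew \<theta>"
  shows "bianchi_sum (\<lambda>v a. \<theta> (v # a)) xs = real (length xs) * \<theta> xs"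
  using assms
proof (induction xs arbitrary: \<theta>)
  case (Cons x xs)
  have "\<theta> (v # x # a) = - \<theta> (x # v # a)" for v a using skewD[OF Cons.prems, of "[]" v x a] by simp
  then have "bianchi_sum (\<lambda>v a. \<theta> (v # x # a)) xs = bianchi_sum (\<lambda>v a. - \<theta> (x # v # a)) xs"
    by (intro bianchi_sum_cong)
  also have "\<dots> = - (length xs * \<theta> (x # xs))"
    using Cons.IH[OF skew_Cons[OF Cons.prems], of x] by (simp add: bianchi_sum_minus)
  finally show ?case by (simp add: algebra_simps)
qed simp

section \<open>Orthonormal bases for an arbitrary inner product\<close>

locale inner_product =
  fixes B :: "'v::euclidean_space \<Rightarrow> 'v \<Rightarrow> real"
  assumes linear_left: "linear (\<lambda>v. B v w)"
    and sym: "B v w = B w v"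
    and pos: "v \<noteq> 0 \<Longrightarrow> 0 < B v v"
begin

lemma linear_right: "linear (B v)"
proof -
  have "B v = (\<lambda>w. B w v)" using sym by blast
  then show ?thesis using linear_left by metis
qed

lemmas B_simps = linear_add[OF linear_left] linear_diff[OF linear_left] linear_cmul[OF linear_left] linear_0[OF linear_left]
  linear_add[OF linear_right] linear_diff[OF linear_right] linear_cmul[OF linear_right] linear_0[OF linear_right]

lemma B_sum: "B (\<Sum>i\<in>I. f i) w = (\<Sum>i\<in>I. B (f i) w)" "B w (\<Sum>i\<in>I. f i) = (\<Sum>i\<in>I. B w (f i))"
  by (rule linear_sum[OF linear_left], rule linear_sum[OF linear_right])

lemma orthonormal_append:
  "orthonormal B (xs @ ys) \<longleftrightarrow> orthonormal B xs \<and> orthonormal B ys \<and> (\<forall>x\<in>set xs. \<forall>y\<in>set ys. B x y = 0)"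
proof
  assume "orthonormal B (xs @ ys)"
  then show "orthonormal B xs \<and> orthonormal B ys \<and> (\<forall>x\<in>set xs. \<forall>y\<in>set ys. B x y = 0)"
    unfolding orthonormal_def by auto
next
  assume R: "orthonormal B xs \<and> orthonormal B ys \<and> (\<forall>x\<in>set xs. \<forall>y\<in>set ys. B x y = 0)"
  then have ne: "x \<noteq> y" if "x \<in> set xs" "y \<in> set ys" for x y
    using that unfolding orthonormal_def by force
  show "orthonormal B (xs @ ys)"
    unfolding orthonormal_def
  proof (intro conjI ballI)
    show "distinct (xs @ ys)" using R ne unfolding orthonormal_def by auto
    fix x y assume "x \<in> set (xs @ ys)" "y \<in> set (xs @ ys)"
    then consider "x \<in> set xs" "y \<in> set xs" | "x \<in> set ys" "y \<in> set ys" | "x \<in> set xs" "y \<in> set ys"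
      | "y \<in> set xs" "x \<in> set ys" by auto
    then show "B x y = (if x = y then 1 else 0)"
    proof cases
      case 4
      then show ?thesis using R ne[of y x] sym[of x y] by auto
    qed (use R ne in \<open>auto simp: orthonormal_def\<close>)
  qed
qed

lemma orthonormal_coeff:
  assumes "orthonormal B es" "e \<in> set es"
  shows "B (\<Sum>f\<in>set es. c f *\<^sub>R f) e = c e"
proof -
  have "B (\<Sum>f\<in>set es. c f *\<^sub>R f) e = (\<Sum>f\<in>set es. if f = e then c f else 0)"
    unfolding B_sum using assms by (intro sum.cong refl) (auto simp: B_simps orthonormal_def)
  then show ?thesis using assms by simp
qed

lemma orthonormal_independent:
  assumes "orthonormal B es"
  shows "independent (set es)"
proof
  assume "dependent (set es)"
  then obtain c v where "v \<in> set es" "c v \<noteq> 0" "(\<Sum>f\<in>set es. c f *\<^sub>R f) = 0"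
    using dependent_finite[of "set es"] by auto
  then show False using orthonormal_coeff[OF assms, of v c] by (simp add: B_simps)
qed

lemma dim_span_orthonormal: "orthonormal B es \<Longrightarrow> dim (span (set es)) = length es"
  using orthonormal_independent[of es] by (simp add: dim_eq_card_independent distinct_card orthonormal_def)

lemma orthonormal_expansion:
  assumes "orthonormal B es" "v \<in> span (set es)"
  shows "v = (\<Sum>e\<in>set es. B v e *\<^sub>R e)"
proof -
  obtain c where v: "v = (\<Sum>e\<in>set es. c e *\<^sub>R e)" using assms(2) span_finite[of "set es"] by auto
  then show ?thesis using orthonormal_coeff[OF assms(1), of _ c] by simp
qed

text \<open>One Gram-Schmidt step.\<close>

lemma orthonormal_extend_one:
  assumes P: "subspace P" and es: "orthonormal B es" "set es \<subseteq> P" and ne: "span (set es) \<noteq> P"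
  shows "\<exists>e\<in>P. orthonormal B (es @ [e])"
proof -
  have "span (set es) \<subseteq> P" using P es by (simp add: span_minimal)
  with ne obtain v where v: "v \<in> P" "v \<notin> span (set es)" by blast
  define s where "s = (\<Sum>e\<in>set es. B v e *\<^sub>R e)"
  define u where "u = v - s"
  have s: "s \<in> span (set es)" unfolding s_def by (intro span_sum span_scale span_base)
  then have u: "u \<noteq> 0" "u \<in> P"
    using v \<open>span (set es) \<subseteq> P\<close> P by (auto simp: u_def intro: subspace_diff)
  have Bu: "B e u = 0" if "e \<in> set es" for e
    using orthonormal_coeff[OF es(1) that, of "B v"] by (simp add: u_def s_def B_simps sym[of e])
  define e where "e = (1 / sqrt (B u u)) *\<^sub>R u"
  have "B e e = 1" using pos[OF u(1)] by (simp add: e_def B_simps)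
  moreover have "B f e = 0" if "f \<in> set es" for f using Bu[OF that] by (simp add: e_def B_simps)
  ultimately have "orthonormal B (es @ [e])" using es(1) unfolding orthonormal_append by (simp add: orthonormal_def)
  moreover have "e \<in> P" unfolding e_def using u P by (simp add: subspace_scale)
  ultimately show ?thesis by blast
qed

lemma orthonormal_extend:
  assumes P: "subspace P" and es: "orthonormal B es" "set es \<subseteq> P"
  shows "\<exists>fs. orthonormal B (es @ fs) \<and> span (set (es @ fs)) = P"
  using es
proof (induction "dim P - length es" arbitrary: es rule: less_induct)
  case (less es)
  show ?case
  proof (cases "span (set es) = P")
    case True
    then show ?thesis using less.prems by (intro exI[of _ "[]"]) simp
  next
    case False
    then obtain e where e: "e \<in> P" "orthonormal B (es @ [e])"
      using orthonormal_extend_one[OF P less.prems] by blast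
    have "length (es @ [e]) \<le> dim P"
      using dim_span_orthonormal[OF e(2)] dim_subset[of "span (set (es @ [e]))" P] e less.prems P
      by (metis (no_types, lifting) empty_iff empty_set le_sup_iff set_ConsD set_append span_minimal subsetI)
    then have "dim P - length (es @ [e]) < dim P - length es" by simp
    from less.hyps[OF this e(2)] e(1) less.prems(2) obtain fs
      where "orthonormal B ((es @ [e]) @ fs)" "span (set ((es @ [e]) @ fs)) = P" by auto
    then show ?thesis by (intro exI[of _ "e # fs"]) simp
  qed
qed

text \<open>Both arguments are expanded in \<open>es\<close>; Parseval's identity for
  \<open>fs\<close> then collapses the double sum. This frees the contraction from the basis chosen
  in its definition.\<close>

lemma trace_independent:
  assumes es: "orthonormal B es" "span (set es) = UNIV" and fs: "orthonormal B fs" "span (set fs) = UNIV"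
    and l: "\<And>w. linear (\<lambda>v. \<beta> v w)" "\<And>v. linear (\<beta> v)"
  shows "(\<Sum>f\<in>set fs. \<beta> f f) = (\<Sum>e\<in>set es. \<beta> e e :: real)"
proof -
  have expand: "\<beta> f f = (\<Sum>e\<in>set es. \<Sum>e'\<in>set es. B f e * B f e' * \<beta> e e')" for f
  proof -
    have f: "f = (\<Sum>e\<in>set es. B f e *\<^sub>R e)" using orthonormal_expansion es by auto
    have "\<beta> f f = \<beta> (\<Sum>e\<in>set es. B f e *\<^sub>R e) f" using f by simp
    also have "\<dots> = (\<Sum>e\<in>set es. B f e * \<beta> e f)"
      by (simp add: linear_sum[OF l(1)] linear_cmul[OF l(1)])
    also have "\<dots> = (\<Sum>e\<in>set es. B f e * (\<Sum>e'\<in>set es. B f e' * \<beta> e e'))"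
    proof (rule sum.cong[OF refl])
      fix e
      have "\<beta> e f = \<beta> e (\<Sum>e\<in>set es. B f e *\<^sub>R e)" using f by simp
      also have "\<dots> = (\<Sum>e'\<in>set es. B f e' * \<beta> e e')"
        by (simp add: linear_sum[OF l(2)] linear_cmul[OF l(2)])
      finally show "B f e * \<beta> e f = B f e * (\<Sum>e'\<in>set es. B f e' * \<beta> e e')" by simp
    qed
    finally show ?thesis by (simp add: sum_distrib_left mult.assoc)
  qed
  have parseval: "(\<Sum>f\<in>set fs. B f e * B f e') = B e e'" for e e'
  proof -
    have "B e e' = B (\<Sum>f\<in>set fs. B e f *\<^sub>R f) e'" using orthonormal_expansion[OF fs(1), of e] fs(2) by simp
    then show ?thesis by (simp add: B_sum B_simps sym[of e])
  qed
  have "(\<Sum>f\<in>set fs. \<beta> f f) = (\<Sum>e\<in>set es. \<Sum>e'\<in>set es. \<Sum>f\<in>set fs. B f e * B f e' * \<beta> e e')"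
    unfolding expand by (simp only: sum.swap[of _ "set fs"])
  also have "\<dots> = (\<Sum>e\<in>set es. \<Sum>e'\<in>set es. B e e' * \<beta> e e')"
    by (simp only: sum_distrib_right[symmetric] parseval)
  also have "\<dots> = (\<Sum>e\<in>set es. \<Sum>e'\<in>set es. if e' = e then \<beta> e e' else 0)"
    using es(1) by (intro sum.cong refl) (auto simp: orthonormal_def)
  finally show ?thesis by simp
qed

lemma orthonormal_basis_of_iff: "orthonormal_basis_of B P es \<longleftrightarrow> span (set es) = P \<and> orthonormal B es"
  unfolding orthonormal_basis_of_def orthonormal_nth ..

lemma ex_orthonormal_basis: "subspace P \<Longrightarrow> \<exists>es. orthonormal B es \<and> span (set es) = P"
  using orthonormal_extend[of P "[]"] subspace_0 by (force simp: orthonormal_def)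

section \<open>Effective forms in an orthonormal basis\<close>

lemma effective_trace:
  assumes \<omega>: "\<omega> \<in> effective_forms B p q" and E: "orthonormal B E" "span (set E) = UNIV"
  shows "(\<Sum>e\<in>set E. \<omega> (e # xs) (e # ys)) = 0"
proof -
  define es where "es = (SOME es. orthonormal_basis_of B UNIV es)"
  have es: "orthonormal B es" "span (set es) = UNIV"
    using someI_ex[of "orthonormal_basis_of B UNIV"] ex_orthonormal_basis[of UNIV]
    unfolding es_def orthonormal_basis_of_iff by auto
  have df: "\<omega> \<in> double_forms p q" using \<omega> by (simp add: effective_forms_def)
  have "contraction B \<omega> xs ys = (\<Sum>j<length es. \<omega> (es ! j # xs) (es ! j # ys))"
    unfolding contraction_def es_def Let_def ..
  also have "\<dots> = (\<Sum>e\<in>set es. \<omega> (e # xs) (e # ys))"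
    using es(1) by (intro sum.reindex_bij_betw bij_betw_nth) (auto simp: orthonormal_def)
  also have "\<dots> = (\<Sum>e\<in>set E. \<omega> (e # xs) (e # ys))"
    by (rule trace_independent[OF E es])
      (use double_formsD(4)[OF df, of "[]" xs] double_formsD(5)[OF df, of _ "[]" ys] in auto)
  finally show ?thesis using \<omega> by (simp add: effective_forms_def)
qed

text \<open>The contraction runs over the whole basis, but vectors of K, \<open>X\<close> or
  \<open>Y\<close> would be repeated in one of the arguments and drop out. This leaves the
  extensions of K inside \<open>U\<close>, which is why \<open>U\<close> excludes \<open>X\<close>
  and \<open>Y\<close>.\<close>

lemma harmonic_diag_value:
  assumes \<omega>: "\<omega> \<in> effective_forms B p q" and E: "orthonormal B E" "span (set E) = UNIV"
    and U: "U = set E - set X - set Y"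
  shows "harmonic U (diag_value \<omega> X Y)"
  unfolding harmonic_def
proof (intro allI impI)
  fix K assume K: "K \<subseteq> U"
  then have fin: "finite K" using U finite_subset by blast
  have ds: "dskew \<omega>" using \<omega> double_formsD(1) by (auto simp: effective_forms_def)
  have "(\<Sum>j\<in>U - K. diag_value \<omega> X Y (insert j K)) = (\<Sum>j\<in>U - K. \<omega> (j # list_of K @ X) (j # list_of K @ Y))"
  proof (rule sum.cong[OF refl])
    fix j assume "j \<in> U - K"
    then show "diag_value \<omega> X Y (insert j K) = \<omega> (j # list_of K @ X) (j # list_of K @ Y)"
      using diag_value_eq[OF ds, of "j # list_of K" X Y] list_of[OF fin] by simp
  qed
  also have "\<dots> = (\<Sum>j\<in>set E. \<omega> (j # list_of K @ X) (j # list_of K @ Y))"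
  proof (rule sum.mono_neutral_left)
    show "\<forall>j\<in>set E - (U - K). \<omega> (j # list_of K @ X) (j # list_of K @ Y) = 0"
    proof
      fix j assume "j \<in> set E - (U - K)"
      then have "j \<in> K \<union> set X \<union> set Y" unfolding U by blast
      then show "\<omega> (j # list_of K @ X) (j # list_of K @ Y) = 0"
        using list_of[OF fin] by (intro dskew_not_distinct[OF ds]) auto
    qed
  qed (auto simp: U)
  also have "\<dots> = 0" by (rule effective_trace[OF \<omega> E])
  finally show "(\<Sum>j\<in>U - K. diag_value \<omega> X Y (insert j K)) = 0" .
qed

lemma sum_diag_value_degree:
  assumes \<omega>: "\<And>i. i \<le> p \<Longrightarrow> \<omega> i \<in> double_forms i i" and K: "finite K"
  shows "(\<Sum>i\<le>p. c i * diag_value (\<omega> i) X Y K) =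
    (if card K + length X \<le> p then c (card K + length X) * diag_value (\<omega> (card K + length X)) X Y K else 0)"
proof -
  have "diag_value (\<omega> i) X Y K = 0" if "i \<le> p" "i \<noteq> card K + length X" for i
    unfolding diag_value_def using that K by (intro double_formsD(2)[OF \<omega>]) (auto simp: length_list_of)
  then have "(\<Sum>i\<le>p. c i * diag_value (\<omega> i) X Y K) =
      (\<Sum>i\<le>p. if i = card K + length X then c i * diag_value (\<omega> i) X Y K else 0)"
    by (intro sum.cong) auto
  then show ?thesis by (simp add: sum.delta)
qed

text \<open>All components are merged into one function on subsets of a basis, the component of
  degree i supplying the values on i-element sets. Merging keeps harmonicity, since each relation
  involves sets of one size only; hence \<open>harmonic_eq_zero\<close> removes all degrees at
  once.\<close>

lemma separate_components:
  assumes \<omega>: "\<And>i. i \<le> p \<Longrightarrow> \<omega> i \<in> effective_forms B i i"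
    and d: "p \<le> d" "d + p \<le> DIM('v)"
    and s: "\<And>es. orthonormal B es \<Longrightarrow> length es = d \<Longrightarrow>
       (\<Sum>i\<le>p. c i * (\<Sum>K\<in>Pow (set es). diag_value (\<omega> i) [] [] K)) = lam"
  shows "c 0 * \<omega> 0 [] [] = lam"
    and "1 \<le> i \<Longrightarrow> i \<le> p \<Longrightarrow> c i \<noteq> 0 \<Longrightarrow> orthonormal B l \<Longrightarrow> length l = i \<Longrightarrow> \<omega> i l l = 0"
proof -
  have df: "\<omega> i \<in> double_forms i i" if "i \<le> p" for i using \<omega>[OF that] by (simp add: effective_forms_def)
  define g where "g = (\<lambda>K. if card K \<le> p then c (card K) * diag_value (\<omega> (card K)) [] [] K else 0)"
  \<comment> \<open>Subtracting \<open>lam\<close> at the empty set makes the sums over d-element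
    sets vanish, and no harmonicity relation contains the empty set.\<close>
  define f where "f = (\<lambda>K :: 'v set. g K - (if K = {} then lam else 0))"
  have f0: "f K = 0" if l: "orthonormal B l" and K: "K \<subseteq> set l" for l K
  proof -
    obtain fs where E: "orthonormal B (l @ fs)" "span (set (l @ fs)) = UNIV"
      using orthonormal_extend[of UNIV l] l by auto
    define U where "U = set (l @ fs)"
    have fin: "finite K" if "K \<subseteq> U" for K using that finite_subset unfolding U_def by blast
    have "card U = length (l @ fs)" unfolding U_def using E(1) by (intro distinct_card) (simp add: orthonormal_def)
    then have cU: "card U = DIM('v)" using dim_span_orthonormal[OF E(1)] unfolding E(2) by simp
    show ?thesis
    proof (rule harmonic_eq_zero[where U = U and f = f and p = p and r = d])
      show "harmonic U f" unfolding harmonic_def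
      proof (intro allI impI)
        fix K assume K: "K \<subseteq> U"
        show "(\<Sum>j\<in>U - K. f (insert j K)) = 0"
        proof (cases "Suc (card K) \<le> p")
          case True
          have "(\<Sum>j\<in>U - K. f (insert j K)) = (\<Sum>j\<in>U - K. c (Suc (card K)) * diag_value (\<omega> (Suc (card K))) [] [] (insert j K))"
            using fin[OF K] True by (intro sum.cong refl) (simp add: f_def g_def)
          also have "\<dots> = c (Suc (card K)) * 0"
            using harmonic_diag_value[OF \<omega>[OF True] E, of U "[]" "[]"] K
            unfolding harmonic_def U_def sum_distrib_left[symmetric] by auto
          finally show ?thesis by simp
        next
          case False
          then show ?thesis using fin[OF K] by (intro sum.neutral) (auto simp: f_def g_def)
        qed
      qed
      show "f K = 0" if "K \<subseteq> U" "p < card K" for K using that by (auto simp: f_def g_def)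
      show "p \<le> d" "d + p \<le> card U" using d cU by auto
      show "(\<Sum>K\<in>Pow A. f K) = 0" if A: "A \<subseteq> U" "card A = d" for A
      proof -
        have o: "orthonormal B (list_of A)" "set (list_of A) = A" "length (list_of A) = d"
          using orthonormal_mono[OF E(1), of "list_of A"] list_of[OF fin[OF A(1)]] A length_list_of[OF fin[OF A(1)]]
          unfolding U_def by auto
        have "(\<Sum>K\<in>Pow A. f K) = (\<Sum>K\<in>Pow A. g K) - (\<Sum>K\<in>Pow A. if K = {} then lam else 0)"
          unfolding f_def by (rule sum_subtractf)
        also have "(\<Sum>K\<in>Pow A. if K = {} then lam else 0) = lam" using fin[OF A(1)] by simp
        also have "(\<Sum>K\<in>Pow A. g K) = (\<Sum>K\<in>Pow A. \<Sum>i\<le>p. c i * diag_value (\<omega> i) [] [] K)"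
        proof (rule sum.cong[OF refl])
          fix K assume "K \<in> Pow A"
          then have "finite K" using A(1) fin[of K] by auto
          from sum_diag_value_degree[OF df this, of p c "[]" "[]"]
          show "g K = (\<Sum>i\<le>p. c i * diag_value (\<omega> i) [] [] K)" by (simp add: g_def)
        qed
        also have "\<dots> = (\<Sum>i\<le>p. c i * (\<Sum>K\<in>Pow A. diag_value (\<omega> i) [] [] K))"
          by (subst sum.swap) (simp add: sum_distrib_left)
        also have "\<dots> = lam" using s[OF o(1,3)] o(2) by simp
        finally show ?thesis by simp
      qed
    qed (use K U_def in auto)
  qed
  have l0: "list_of {} = ([] :: 'v list)" using list_of(2)[of "{}"] by simp
  show "c 0 * \<omega> 0 [] [] = lam"
    using f0[of "[]" "{}"] by (simp add: f_def g_def diag_value_def l0 orthonormal_def)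
  show "\<omega> i l l = 0" if "1 \<le> i" "i \<le> p" "c i \<noteq> 0" "orthonormal B l" "length l = i"
  proof -
    have "card (set l) = i" using that by (simp add: orthonormal_def distinct_card)
    moreover from this have "set l \<noteq> {}" using that by auto
    ultimately have "diag_value (\<omega> i) [] [] (set l) = 0"
      using f0[OF that(4), of "set l"] that by (simp add: f_def g_def)
    then show ?thesis
      using diag_value_eq[OF double_formsD(1)[OF df[OF that(2)]], of l "[]" "[]"] that(4)
      by (simp add: orthonormal_def)
  qed
qed

text \<open>The first Bianchi identity passes from a form to its effective components: on
  orthonormal lists it is again a relation between harmonic functions of the common part \<open>K\<close>
  of the two arguments, so \<open>harmonic_eq_zero\<close> separates the degrees.\<close>

lemma component_bianchi:
  assumes \<omega>: "\<And>i. i \<le> p \<Longrightarrow> \<omega> i \<in> effective_forms B i i"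
    and \<Omega>: "\<And>xs ys. \<Omega> xs ys = (\<Sum>i\<le>p. df_mult (df_power (metric_form B) (p - i)) (\<omega> i) xs ys)"
    and bi: "bianchi \<Omega>" and p: "2 * p \<le> DIM('v)"
    and o: "orthonormal B (K @ X @ Y)" "length X = Suc d" "Suc (length Y) = d" "length K + d = i" "i \<le> p"
  shows "bianchi_sum (\<lambda>v a. \<omega> i (K @ a) (K @ Y @ [v])) X = 0"
proof -
  have df: "\<omega> i \<in> double_forms i i" if "i \<le> p" for i using \<omega>[OF that] by (simp add: effective_forms_def)
  have ds: "dskew (\<omega> i)" if "i \<le> p" for i using double_formsD(1) df[OF that] .
  obtain fs where E: "orthonormal B ((K @ X @ Y) @ fs)" "span (set ((K @ X @ Y) @ fs)) = UNIV"
    using orthonormal_extend[of UNIV "K @ X @ Y"] o(1) by auto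
  define E where "E = (K @ X @ Y) @ fs"
  note E = E[folded E_def]
  have D: "distinct E" using E(1) by (simp add: orthonormal_def)
  define U where "U = set E - set X - set Y"
  have fin: "finite K" if "K \<subseteq> U" for K using that finite_subset unfolding U_def by blast
  have KU: "set K \<subseteq> U" using D unfolding U_def E_def by auto
  have "card (set E) = DIM('v)" using dim_span_orthonormal[OF E(1)] distinct_card[OF D] unfolding E(2) by simp
  moreover have "card (set E - set X - set Y) = card (set E) - card (set X) - card (set Y)"
    using D unfolding E_def by (subst card_Diff_subset, simp, force, subst card_Diff_subset) auto
  moreover have "card (set X) = Suc d" "card (set Y) = d - 1" using D o by (simp_all add: E_def distinct_card)
  ultimately have cU: "card U = DIM('v) - 2 * d" using o(3) unfolding U_def by simp
  have parts: "set E - set a - set (Y @ [v]) = U" "length a = d"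
    if "mset (v # a) = mset X" for v a
  proof -
    have "set X = insert v (set a)" using mset_eq_setD[OF that] by simp
    then show "set E - set a - set (Y @ [v]) = U" unfolding U_def by auto
    show "length a = d" using mset_eq_length[OF that] o(2) by simp
  qed
  \<comment> \<open>\<open>h i K\<close> is the Bianchi sum of the i-th component with common part
    K. Its degree i is \<open>card K + d\<close>, and f weights it by the factor
    \<open>(p - i)!\<close> produced by \<open>g^(p-i)\<close>.\<close>
  define h where "h = (\<lambda>i K. bianchi_sum (\<lambda>v a. diag_value (\<omega> i) a (Y @ [v]) K) X)"
  define f where "f = (\<lambda>K. if card K + d \<le> p then fact (p - (card K + d)) * h (card K + d) K else 0)"
  \<comment> \<open>Sets of size \<open>p - d\<close> together with the d entries that remain of
    \<open>X\<close> fill an argument of \<Omega>. As \<open>X\<close> and \<open>Y\<close> have 2d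
    entries in all, U has n - 2d elements, enough for twice that size because \<open>2 * p\<close>
    is at most n.\<close>
  have "f (set K) = 0"
  proof (rule harmonic_eq_zero[where U = U and f = f and p = "p - d" and r = "p - d"])
    show "harmonic U f" unfolding harmonic_def
    proof (intro allI impI)
      fix K assume K: "K \<subseteq> U"
      show "(\<Sum>j\<in>U - K. f (insert j K)) = 0"
      proof (cases "Suc (card K) + d \<le> p")
        case True
        let ?i = "Suc (card K) + d"
        have "(\<Sum>j\<in>U - K. f (insert j K)) = (\<Sum>j\<in>U - K. fact (p - ?i) * h ?i (insert j K))"
          using fin[OF K] True by (intro sum.cong refl) (simp add: f_def)
        also have "\<dots> = bianchi_sum (\<lambda>v a. \<Sum>j\<in>U - K. fact (p - ?i) * diag_value (\<omega> ?i) a (Y @ [v]) (insert j K)) X"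
          unfolding h_def
          by (rule bianchi_sum_lincomb[of "\<lambda>_. fact (p - ?i)" "\<lambda>j v a. diag_value (\<omega> ?i) a (Y @ [v]) (insert j K)", symmetric])
        also have "\<dots> = bianchi_sum (\<lambda>v a. 0) X"
        proof (rule bianchi_sum_cong)
          fix v a assume va: "mset (v # a) = mset X"
          have "harmonic U (diag_value (\<omega> ?i) a (Y @ [v]))"
            using harmonic_diag_value[OF \<omega>[OF True] E, of U a "Y @ [v]"] parts[OF va] by simp
          then show "(\<Sum>j\<in>U - K. fact (p - ?i) * diag_value (\<omega> ?i) a (Y @ [v]) (insert j K)) = 0"
            using K unfolding harmonic_def sum_distrib_left[symmetric] by simp
        qed
        finally show ?thesis by simp
      next
        case False
        then show ?thesis using fin[OF K] by (intro sum.neutral) (auto simp: f_def)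
      qed
    qed
    show "f K = 0" if "K \<subseteq> U" "p - d < card K" for K using that by (auto simp: f_def)
    show "p - d + (p - d) \<le> card U" using cU p by simp
    show "(\<Sum>K\<in>Pow A. f K) = 0" if A: "A \<subseteq> U" "card A = p - d" for A
    proof -
      let ?l = "list_of A"
      have l: "distinct ?l" "set ?l = A" "length ?l = p - d"
        using list_of[OF fin[OF A(1)]] A length_list_of[OF fin[OF A(1)]] by auto
      have sk: "skew (\<Omega> a)" for a
        unfolding \<Omega>[abs_def]
        using skew_sum[of "{..p}" "\<lambda>i. df_mult (df_power (metric_form B) (p - i)) (\<omega> i) a" "\<lambda>_. 1"]
          dskew_df_mult[OF dskew_metric_power ds] by (simp add: dskew_def)
      \<comment> \<open>The list \<open>?l\<close> occurs in both arguments, so only the terms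
        splitting off an entry of \<open>X\<close> survive.\<close>
      have "0 = bianchi_sum (\<lambda>v a. \<Omega> a ((?l @ Y) @ [v])) (?l @ X)"
        using bi[unfolded bianchi_def, rule_format, of "?l @ Y" "?l @ X"] by simp
      also have "\<dots> = (-1) ^ length ?l * bianchi_sum (\<lambda>v a. \<Omega> (?l @ a) ((?l @ Y) @ [v])) X"
        by (rule bianchi_sum_append) (rule skew_not_distinct[OF sk], auto)
      finally have "0 = bianchi_sum (\<lambda>v a. \<Omega> (?l @ a) ((?l @ Y) @ [v])) X" by simp
      also have "\<dots> = bianchi_sum (\<lambda>v a. \<Sum>K\<in>Pow A. (if card K + d \<le> p then fact (p - (card K + d)) else 0) *
          diag_value (\<omega> (card K + d)) a (Y @ [v]) K) X"
      proof (rule bianchi_sum_cong)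
        fix v a assume va: "mset (v # a) = mset X"
        have X: "set X = insert v (set a)" "distinct (v # a)"
          using mset_eq_setD[OF va] mset_eq_imp_distinct_iff[OF va] D unfolding E_def by auto
        have oo: "orthonormal B (?l @ a @ (Y @ [v]))"
        proof (rule orthonormal_mono[OF E(1)])
          show "distinct (?l @ a @ (Y @ [v]))"
            using l A(1) X D unfolding U_def E_def by auto
          show "set (?l @ a @ (Y @ [v])) \<subseteq> set E" using l A(1) X unfolding U_def E_def by auto
        qed
        have "\<Omega> (?l @ a) ((?l @ Y) @ [v]) =
          (\<Sum>i\<le>p. fact (p - i) * (\<Sum>K\<in>Pow (set ?l). diag_value (\<omega> i) a (Y @ [v]) K))"
          unfolding \<Omega>
        proof (rule sum.cong[OF refl])
          fix i assume i: "i \<in> {..p}"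
          have "df_mult (df_power (metric_form B) (p - i)) (\<omega> i) (?l @ a) (?l @ (Y @ [v])) =
            fact (p - i) * (\<Sum>K\<in>Pow (set ?l). diag_value (\<omega> i) a (Y @ [v]) K)"
            using i l(3) parts(2)[OF va] o(4,5)
            by (intro df_mult_metric_power_degree[OF oo ds] double_formsD(2)[OF df]) auto
          then show "df_mult (df_power (metric_form B) (p - i)) (\<omega> i) (?l @ a) ((?l @ Y) @ [v]) =
            fact (p - i) * (\<Sum>K\<in>Pow (set ?l). diag_value (\<omega> i) a (Y @ [v]) K)" by simp
        qed
        also have "\<dots> = (\<Sum>K\<in>Pow A. \<Sum>i\<le>p. fact (p - i) * diag_value (\<omega> i) a (Y @ [v]) K)"
          unfolding l(2) sum_distrib_left by (rule sum.swap)
        also have "\<dots> = (\<Sum>K\<in>Pow A. (if card K + d \<le> p then fact (p - (card K + d)) else 0) *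
          diag_value (\<omega> (card K + d)) a (Y @ [v]) K)"
        proof (rule sum.cong[OF refl])
          fix K assume "K \<in> Pow A"
          then have "finite K" using A(1) fin[of K] by auto
          from sum_diag_value_degree[OF df this, of p "\<lambda>i. fact (p - i)" a "Y @ [v]"]
          show "(\<Sum>i\<le>p. fact (p - i) * diag_value (\<omega> i) a (Y @ [v]) K) =
            (if card K + d \<le> p then fact (p - (card K + d)) else 0) * diag_value (\<omega> (card K + d)) a (Y @ [v]) K"
            by (simp add: parts(2)[OF va])
        qed
        finally show "\<Omega> (?l @ a) ((?l @ Y) @ [v]) = \<dots>" .
      qed
      also have "\<dots> = (\<Sum>K\<in>Pow A. (if card K + d \<le> p then fact (p - (card K + d)) else 0) * h (card K + d) K)"
        unfolding h_def
        by (rule bianchi_sum_lincomb[of "\<lambda>K. if card K + d \<le> p then fact (p - (card K + d)) else 0"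
              "\<lambda>K v a. diag_value (\<omega> (card K + d)) a (Y @ [v]) K"])
      also have "\<dots> = (\<Sum>K\<in>Pow A. f K)" by (intro sum.cong) (auto simp: f_def)
      finally show ?thesis by simp
    qed
  qed (use KU in \<open>auto simp: U_def\<close>)
  moreover have "card (set K) = length K" using D unfolding E_def by (simp add: distinct_card)
  ultimately have "h i (set K) = 0" using o(4,5) by (simp add: f_def)
  moreover have "h i (set K) = bianchi_sum (\<lambda>v a. \<omega> i (K @ a) (K @ Y @ [v])) X"
    unfolding h_def using D
    by (intro bianchi_sum_cong diag_value_eq[OF ds[OF o(5)], symmetric]) (simp add: E_def)
  ultimately show ?thesis by simp
qed

text \<open>Induction on the number of vectors in which the two arguments differ. Polarising a common
  vector shows that exchanging a vector of one argument with one of the other changes the sign,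
  which makes all terms of the Bianchi identity equal.\<close>

lemma eq_0_of_diagonal:
  assumes df: "\<omega> \<in> double_forms i i"
    and diag: "\<And>l. orthonormal B l \<Longrightarrow> length l = i \<Longrightarrow> \<omega> l l = 0"
    and bi: "\<And>K X Y d. orthonormal B (K @ X @ Y) \<Longrightarrow> length X = Suc d \<Longrightarrow> Suc (length Y) = d \<Longrightarrow>
      length K + d = i \<Longrightarrow> bianchi_sum (\<lambda>v a. \<omega> (K @ a) (K @ Y @ [v])) X = 0"
  shows "\<omega> = (\<lambda>xs ys. 0)"
proof -
  have sk: "skew (\<omega> xs)" "skew (\<lambda>xs. \<omega> xs ys)" for xs ys using double_formsD(1)[OF df] unfolding dskew_def by auto
  have skK: "skew (\<lambda>a. \<theta> (K @ a))" if "skew \<theta>" for \<theta> :: "'v list \<Rightarrow> real" and K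
  proof (rule skewI)
    fix us a b vs
    show "\<theta> (K @ us @ a # b # vs) = - \<theta> (K @ us @ b # a # vs)"
      using skewD[OF that, of "K @ us" a b vs] by simp
  qed
  have off: "\<omega> (K @ X) (K @ Y) = 0"
    if "orthonormal B (K @ X @ Y)" "length X = d" "length Y = d" "length K + d = i" for K X Y d
    using that
  proof (induction d arbitrary: K X Y)
    case 0
    then show ?case using diag[of K] by simp
  next
    case (Suc d)
    have swap: "\<omega> (K @ x # X) (K @ y # Y) = - \<omega> (K @ y # X) (K @ x # Y)"
      if o: "orthonormal B (K @ [x, y] @ X @ Y)" and l: "length X = d" "length Y = d" for x y X Y
    proof -
      \<comment> \<open>A unit vector, so that the induction hypothesis applies with
        \<open>z\<close> as a further common vector; the pure terms in \<open>x\<close> and in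
        \<open>y\<close> vanish for the same reason.\<close>
      define z where "z = (1 / sqrt 2) *\<^sub>R (x + y)"
      have xy: "B x x = 1" "B y y = 1" "B x y = 0" "B y x = 0"
        using o unfolding orthonormal_append by (auto simp: orthonormal_def)
      have "B z z = 1" using xy by (simp add: z_def B_simps field_simps)
      then have oz: "orthonormal B ((K @ [z]) @ X @ Y)"
        using o unfolding orthonormal_append by (auto simp: orthonormal_def z_def B_simps)
      have ox: "orthonormal B ((K @ [x]) @ X @ Y)" "orthonormal B ((K @ [y]) @ X @ Y)"
        by (rule orthonormal_mono[OF o]; use o in \<open>auto simp: orthonormal_def\<close>)+
      have z: "\<omega> (K @ w # X) (K @ w # Y) = 0" if "orthonormal B ((K @ [w]) @ X @ Y)" for w
        using Suc.IH[OF that l] Suc.prems(4) by simp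
      have "0 = \<omega> (K @ z # X) (K @ z # Y)" using z[OF oz] by simp
      also have "\<dots> = 1 / 2 * (\<omega> (K @ x # X) (K @ x # Y) + \<omega> (K @ y # X) (K @ x # Y) +
         (\<omega> (K @ x # X) (K @ y # Y) + \<omega> (K @ y # X) (K @ y # Y)))"
      proof -
        have l: "\<omega> (K @ z # X) ys = 1 / sqrt 2 * (\<omega> (K @ x # X) ys + \<omega> (K @ y # X) ys)" for ys
          unfolding z_def linear_cmul[OF double_formsD(4)[OF df]] linear_add[OF double_formsD(4)[OF df]] by simp
        have r: "\<omega> xs (K @ z # Y) = 1 / sqrt 2 * (\<omega> xs (K @ x # Y) + \<omega> xs (K @ y # Y))" for xs
          unfolding z_def linear_cmul[OF double_formsD(5)[OF df]] linear_add[OF double_formsD(5)[OF df]] by simp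
        have "1 / sqrt 2 * (1 / sqrt 2 * t) = 1 / 2 * t" for t :: real by simp
        then show ?thesis unfolding l r by (simp only: flip: distrib_left)
      qed
      finally show ?thesis using z[OF ox(1)] z[OF ox(2)] by simp
    qed
    obtain y Y' where Y: "Y = y # Y'" using Suc.prems(3) by (cases Y) auto
    have lY: "length Y' = d" using Suc.prems(3) Y by simp
    define \<theta> where "\<theta> = (\<lambda>a. \<omega> (K @ a) (K @ Y' @ [y]))"
    have "skew \<theta>" unfolding \<theta>_def by (rule skK[OF sk(2)])
    have mv: "\<omega> xs (K @ Y' @ [v]) = (-1) ^ d * \<omega> xs (K @ v # Y')" for xs v
      using skew_move[OF skK[OF sk(1)], of xs K Y' v "[]"] lY by simp
    have "orthonormal B (K @ (y # X) @ Y')"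
      using Suc.prems(1) by (rule orthonormal_mono) (use Suc.prems(1) Y in \<open>auto simp: orthonormal_def\<close>)
    \<comment> \<open>With \<open>y\<close> transferred to the first argument, the term that returns
      it is \<open>\<theta> X\<close>. By \<open>swap\<close> each of the other d + 1 terms
      contributes \<open>\<theta> X\<close> as well, so that
      \<open>(d + 2) * \<theta> X = 0\<close>.\<close>
    then have "0 = bianchi_sum (\<lambda>v a. \<omega> (K @ a) (K @ Y' @ [v])) (y # X)"
      using bi[of K "y # X" Y' "Suc d"] Suc.prems(2,4) lY by simp
    also have "\<dots> = \<theta> X - bianchi_sum (\<lambda>v a. \<omega> (K @ y # a) (K @ Y' @ [v])) X" by (simp add: \<theta>_def)
    also have "bianchi_sum (\<lambda>v a. \<omega> (K @ y # a) (K @ Y' @ [v])) X = bianchi_sum (\<lambda>v a. - \<theta> (v # a)) X"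
    proof (rule bianchi_sum_cong)
      fix v a assume va: "mset (v # a) = mset X"
      have X: "set X = insert v (set a)" "distinct (v # a)" "length a = d"
        using mset_eq_setD[OF va] mset_eq_imp_distinct_iff[OF va] mset_eq_length[OF va] Suc.prems(1,2)
        by (auto simp: orthonormal_def)
      have "orthonormal B (K @ [y, v] @ a @ Y')"
        using Suc.prems(1) by (rule orthonormal_mono) (use Suc.prems(1) X Y in \<open>auto simp: orthonormal_def\<close>)
      from swap[OF this X(3) lY]
      show "\<omega> (K @ y # a) (K @ Y' @ [v]) = - \<theta> (v # a)" unfolding \<theta>_def mv by simp
    qed
    also have "\<dots> = - (Suc d * \<theta> X)"
      unfolding bianchi_sum_minus bianchi_sum_skew[OF \<open>skew \<theta>\<close>] Suc.prems(2) ..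
    finally have "(2 + real d) * \<theta> X = 0" by (simp add: algebra_simps)
    then have "\<theta> X = 0" by simp
    then show ?case unfolding \<theta>_def mv Y by simp
  qed
  obtain E where E: "orthonormal B E" "span (set E) = UNIV" using ex_orthonormal_basis[of UNIV] by auto
  show ?thesis
  proof (rule double_form_eq_0[OF df E(2)])
    fix xs ys assume s: "set xs \<subseteq> set E" "set ys \<subseteq> set E"
    show "\<omega> xs ys = 0"
    proof (cases "distinct xs \<and> distinct ys \<and> length xs = i \<and> length ys = i")
      case True
      define K X Y where "K = filter (\<lambda>x. x \<in> set ys) xs" "X = filter (\<lambda>x. x \<notin> set ys) xs"
        "Y = filter (\<lambda>y. y \<notin> set xs) ys"
      have m: "mset xs = mset (K @ X)" "mset ys = mset (K @ Y)"
        by (rule iffD1[OF set_eq_iff_mset_eq_distinct]; use True in \<open>auto simp: K_X_Y_def\<close>)+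
      have "orthonormal B (K @ X @ Y)"
        using E(1) by (rule orthonormal_mono) (use True s in \<open>auto simp: K_X_Y_def\<close>)
      then have "\<omega> (K @ X) (K @ Y) = 0"
        using mset_eq_length[OF m(1)] mset_eq_length[OF m(2)] True by (intro off[where d = "length X"]) auto
      moreover obtain s where "\<omega> xs ys = s * \<omega> (K @ X) ys" using skew_perm[OF m(1)] sk(2) by blast
      moreover obtain t where "\<omega> (K @ X) ys = t * \<omega> (K @ X) (K @ Y)" using skew_perm[OF m(2)] sk(1) by blast
      ultimately show ?thesis by simp
    next
      case False
      then show ?thesis using dskew_not_distinct[OF double_formsD(1)[OF df]] double_formsD(2,3)[OF df] by blast
    qed
  qed
qed

lemma components_eq_0:
  assumes \<omega>: "\<And>i. i \<le> p \<Longrightarrow> \<omega> i \<in> effective_forms B i i"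
    and \<Omega>: "\<And>xs ys. \<Omega> xs ys = (\<Sum>i\<le>p. df_mult (df_power (metric_form B) (p - i)) (\<omega> i) xs ys)"
    and bi: "bianchi \<Omega>" and d: "p \<le> d" "d + p \<le> DIM('v)"
    and s: "\<And>es. orthonormal B es \<Longrightarrow> length es = d \<Longrightarrow>
       (\<Sum>i\<le>p. c i * (\<Sum>K\<in>Pow (set es). diag_value (\<omega> i) [] [] K)) = lam"
    and i: "1 \<le> i" "i \<le> p" "c i \<noteq> 0"
  shows "\<omega> i = (\<lambda>xs ys. 0)"
proof (rule eq_0_of_diagonal)
  show "\<omega> i \<in> double_forms i i" using \<omega>[OF i(2)] by (simp add: effective_forms_def)
  show "\<omega> i l l = 0" if "orthonormal B l" "length l = i" for l
    using separate_components(2)[where \<omega> = \<omega> and c = c, OF \<omega> d s i that] .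
  show "bianchi_sum (\<lambda>v a. \<omega> i (K @ a) (K @ Y @ [v])) X = 0"
    if "orthonormal B (K @ X @ Y)" "length X = Suc e" "Suc (length Y) = e" "length K + e = i" for K X Y e
    using component_bianchi[OF \<omega> \<Omega> bi _ that i(2)] d by simp
qed

end


section \<open>The curvatures of a plane and of its orthogonal complement\<close>

text \<open>For an orthonormal set A and \<omega> of bidegree (i, i) this is 1/i! times the full
  contraction of \<omega> restricted to the span of A.\<close>

definition trace_sum :: "'v double_form \<Rightarrow> 'v set \<Rightarrow> real" where
  "trace_sum \<omega> A = (\<Sum>K\<in>Pow A. diag_value \<omega> [] [] K)"

context inner_product
begin

lemma trace_sum_compl:
  assumes \<omega>: "\<omega> \<in> effective_forms B i i" and o: "orthonormal B (es @ fs)" "span (set (es @ fs)) = UNIV"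
  shows "trace_sum \<omega> (set fs) = (-1) ^ i * trace_sum \<omega> (set es)"
proof -
  let ?U = "set (es @ fs)"
  have "(\<Sum>K\<in>Pow (?U - set es). diag_value \<omega> [] [] K) = (-1) ^ i * (\<Sum>K\<in>Pow (set es). diag_value \<omega> [] [] K)"
  proof (rule harmonic_sum_compl)
    show "harmonic ?U (diag_value \<omega> [] [])" by (rule harmonic_diag_value[OF \<omega> o]) simp
    fix K assume "K \<subseteq> ?U" "card K \<noteq> i"
    moreover from this have "finite K" using finite_subset by blast
    ultimately show "diag_value \<omega> [] [] K = 0" unfolding diag_value_def using \<omega>
      by (intro double_formsD(2)) (auto simp: length_list_of effective_forms_def)
  qed auto
  moreover have "?U - set es = set fs" using o(1) by (auto simp: orthonormal_def)
  ultimately show ?thesis by (simp add: trace_sum_def)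
qed

lemma orthonormal_compl:
  assumes o: "orthonormal B (es @ fs)" "span (set (es @ fs)) = UNIV"
  shows "orth_compl B (span (set es)) = span (set fs)"
proof (intro subset_antisym subsetI)
  fix v assume v: "v \<in> orth_compl B (span (set es))"
  have D: "distinct (es @ fs)" using o(1) by (simp add: orthonormal_def)
  have "v = (\<Sum>e\<in>set (es @ fs). B v e *\<^sub>R e)" using orthonormal_expansion[OF o(1), of v] o(2) by simp
  also have "\<dots> = (\<Sum>e\<in>set fs. B v e *\<^sub>R e)"
  proof (rule sum.mono_neutral_right)
    show "\<forall>e\<in>set (es @ fs) - set fs. B v e *\<^sub>R e = 0"
      using v by (auto simp: orth_compl_def span_base)
  qed auto
  also have "\<dots> \<in> span (set fs)" by (intro span_sum span_scale span_base)
  finally show "v \<in> span (set fs)" .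
next
  fix v assume v: "v \<in> span (set fs)"
  have "B f w = 0" if f: "f \<in> set fs" and w: "w \<in> span (set es)" for f w
    using linear_eq_0_on_span[OF linear_right _ w, of f] o(1) f unfolding orthonormal_append by (auto simp: sym)
  then have "B v w = 0" if "w \<in> span (set es)" for w
    using linear_eq_0_on_span[OF linear_left _ v, of w] that by blast
  then show "v \<in> orth_compl B (span (set es))" by (simp add: orth_compl_def)
qed

lemma orthonormal_commute: "orthonormal B (es @ fs) \<Longrightarrow> orthonormal B (fs @ es)"
  by (rule orthonormal_mono[of B "es @ fs"]) (auto simp: orthonormal_def)

text \<open>Sectional curvature is defined through a chosen basis of the plane, which has to be
  exchanged for a given one.\<close>

lemma orthonormal_replace:
  assumes o: "orthonormal B (es @ fs)" "span (set (es @ fs)) = UNIV"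
    and fs': "orthonormal B fs'" "span (set fs') = span (set fs)"
  shows "orthonormal B (es @ fs')" "span (set (es @ fs')) = UNIV"
proof -
  have "B e f = 0" if "e \<in> set es" "f \<in> set fs'" for e f
  proof -
    have "f \<in> orth_compl B (span (set es))"
      using orthonormal_compl[OF o] fs'(2) that(2) span_base by blast
    then have "B f e = 0" using that(1) by (simp add: orth_compl_def span_base)
    then show ?thesis by (simp add: sym[of e f])
  qed
  then show "orthonormal B (es @ fs')" using o(1) fs'(1) unfolding orthonormal_append by blast
  have "set fs \<subseteq> span (set fs')" using fs'(2) span_superset by blast
  then have "set (es @ fs) \<subseteq> span (set (es @ fs'))"
    using span_mono[of "set fs'" "set (es @ fs')"] by (auto intro: span_base)
  then show "span (set (es @ fs')) = UNIV" using o(2) by (metis span_minimal subspace_span top.extremum_uniqueI)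
qed

text \<open>The choice depends on the plane alone, so a single list serves every \<eta>.\<close>

lemma sectional_curvature_basis:
  assumes "subspace P"
  obtains es where "orthonormal B es" "span (set es) = P" "\<And>\<eta>. sectional_curvature B \<eta> P = \<eta> es es"
proof -
  let ?es = "SOME es. orthonormal_basis_of B P es"
  have "orthonormal_basis_of B P ?es"
    using someI_ex[of "orthonormal_basis_of B P"] ex_orthonormal_basis[OF assms] unfolding orthonormal_basis_of_iff by blast
  then show ?thesis using that[of ?es] unfolding orthonormal_basis_of_iff sectional_curvature_def Let_def by blast
qed

section \<open>Diagonal values of a decomposed form and of its products with metric powers\<close>

lemma decomposition_diag:
  assumes dec: "effective_decomposition B p \<Omega> \<omega>" and es: "orthonormal B es" "length es = p"
  shows "\<Omega> es es = (\<Sum>i\<le>p. fact (p - i) * trace_sum (\<omega> i) (set es))"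
proof -
  have df: "\<omega> i \<in> double_forms i i" if "i \<le> p" for i
    using dec that by (simp add: effective_decomposition_def effective_forms_def)
  have "\<Omega> es es = (\<Sum>i\<le>p. df_mult (df_power (metric_form B) (p - i)) (\<omega> i) es es)"
    using dec by (simp add: effective_decomposition_def)
  also have "\<dots> = (\<Sum>i\<le>p. fact (p - i) * trace_sum (\<omega> i) (set es))"
  proof (rule sum.cong[OF refl])
    fix i assume i: "i \<in> {..p}"
    have "df_mult (df_power (metric_form B) (p - i)) (\<omega> i) (es @ []) (es @ []) =
       fact (p - i) * (\<Sum>K\<in>Pow (set es). diag_value (\<omega> i) [] [] K)"
      using i es double_formsD(1,2)[OF df[of i]] by (intro df_mult_metric_power_degree) auto
    then show "df_mult (df_power (metric_form B) (p - i)) (\<omega> i) es es = fact (p - i) * trace_sum (\<omega> i) (set es)"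
      by (simp add: trace_sum_def)
  qed
  finally show ?thesis .
qed

text \<open>\<Omega> is evaluated on the p-element subsets of \<open>es\<close> and the subsets are
  recounted, so that the powers of g need not be combined algebraically. The coefficient is
  \<open>(p - i)!\<close> times the binomial of d - i over p - i.\<close>

lemma metric_power_decomposition_diag:
  assumes dec: "effective_decomposition B p \<Omega> \<omega>" and es: "orthonormal B es" "length es = d" and p: "p \<le> d"
  shows "1 / fact (d - p) * df_mult (df_power (metric_form B) (d - p)) \<Omega> es es =
    (\<Sum>i\<le>p. fact (d - i) / fact (d - p) * trace_sum (\<omega> i) (set es))"
proof -
  have df: "\<omega> i \<in> double_forms i i" if "i \<le> p" for i
    using dec that by (simp add: effective_decomposition_def effective_forms_def)
  have \<Omega>: "\<Omega> xs ys = (\<Sum>i\<le>p. df_mult (df_power (metric_form B) (p - i)) (\<omega> i) xs ys)" for xs ys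
    using dec by (simp add: effective_decomposition_def)
  have ds: "dskew (df_mult (df_power (metric_form B) (p - i)) (\<omega> i))" if "i \<le> p" for i
    using that double_formsD(1)[OF df] by (intro dskew_df_mult dskew_metric_power) auto
  have "dskew \<Omega>" unfolding dskew_def \<Omega>[abs_def]
    using skew_sum[of "{..p}" "\<lambda>i. df_mult (df_power (metric_form B) (p - i)) (\<omega> i) xs" "\<lambda>_. 1" for xs]
      skew_sum[of "{..p}" "\<lambda>i xs. df_mult (df_power (metric_form B) (p - i)) (\<omega> i) xs ys" "\<lambda>_. 1" for ys] ds
    by (simp add: dskew_def)
  have "distinct es" using es(1) by (simp add: orthonormal_def)
  then have card: "card (set es) = d" using es(2) by (simp add: distinct_card)
  let ?P = "{K \<in> Pow (set es). card K = p}"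
  have "df_mult (df_power (metric_form B) (d - p)) \<Omega> es es =
     fact (d - p) * (\<Sum>K\<in>{K \<in> Pow (set es). card K + (d - p) = length es}. diag_value \<Omega> [] [] K)"
    using df_mult_metric_power[of B es "[]" "[]" \<Omega> "d - p"] es \<open>dskew \<Omega>\<close> by simp
  also have "{K \<in> Pow (set es). card K + (d - p) = length es} = ?P" using p es(2) by auto
  also have "(\<Sum>K\<in>?P. diag_value \<Omega> [] [] K) = (\<Sum>K\<in>?P. \<Sum>i\<le>p. fact (p - i) * trace_sum (\<omega> i) K)"
  proof (rule sum.cong[OF refl])
    fix K assume K: "K \<in> ?P"
    then have "finite K" using finite_subset by auto
    note l = list_of[OF this] length_list_of[OF this]
    have "orthonormal B (list_of K)" using es(1) by (rule orthonormal_mono) (use l K in auto)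
    then show "diag_value \<Omega> [] [] K = (\<Sum>i\<le>p. fact (p - i) * trace_sum (\<omega> i) K)"
      using decomposition_diag[OF dec, of "list_of K"] l K by (simp add: diag_value_def)
  qed
  also have "\<dots> = (\<Sum>i\<le>p. \<Sum>K\<in>?P. fact (p - i) * trace_sum (\<omega> i) K)" by (rule sum.swap)
  also have "\<dots> = (\<Sum>i\<le>p. fact (d - i) / fact (d - p) * trace_sum (\<omega> i) (set es))"
  proof (rule sum.cong[OF refl])
    fix i assume "i \<in> {..p}"
    then have i: "i \<le> p" by simp
    have "(\<Sum>K\<in>?P. trace_sum (\<omega> i) K) = real ((d - i) choose (p - i)) * trace_sum (\<omega> i) (set es)"
      unfolding trace_sum_def card[symmetric]
    proof (rule sum_subsets_of_subsets)
      fix I assume "I \<subseteq> set es" "card I \<noteq> i"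
      moreover from this have "finite I" using finite_subset by blast
      ultimately show "diag_value (\<omega> i) [] [] I = 0" unfolding diag_value_def
        by (intro double_formsD(2)[OF df[OF i]]) (auto simp: length_list_of)
    qed (use i in auto)
    moreover have "fact (p - i) * real ((d - i) choose (p - i)) = fact (d - i) / fact (d - p)"
      using i p by (subst binomial_fact) auto
    ultimately show "(\<Sum>K\<in>?P. fact (p - i) * trace_sum (\<omega> i) K) = fact (d - i) / fact (d - p) * trace_sum (\<omega> i) (set es)"
      by (simp flip: sum_distrib_left mult.assoc)
  qed
  finally show ?thesis by simp
qed

text \<open>The first curvature is evaluated on the complement, of dimension n - r, and brought back
  to \<open>es\<close> at the price of \<open>(-1)^i\<close>. The second is evaluated on the double
  complement, which is the plane itself, and keeps its signs.\<close>

lemma pq_curvature_pair: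
  assumes dec: "effective_decomposition B (2 * q) (df_power R q) \<omega>"
    and r: "2 * q \<le> r" "r + 2 * q \<le> DIM('v)"
    and es: "orthonormal B es" "length es = r"
  shows "pq_curvature B R r q (span (set es)) = (\<Sum>i\<le>2 * q. (-1) ^ i * fact (DIM('v) - r - i) / fact (DIM('v) - 2 * q - r) *
      trace_sum (\<omega> i) (set es))"
    and "pq_curvature B R (DIM('v) - r) q (orth_compl B (span (set es))) =
      (\<Sum>i\<le>2 * q. fact (r - i) / fact (r - 2 * q) * trace_sum (\<omega> i) (set es))"
proof -
  let ?n = "DIM('v)"
  have eff: "\<omega> i \<in> effective_forms B i i" if "i \<le> 2 * q" for i
    using dec that by (simp add: effective_decomposition_def)
  obtain fs where o: "orthonormal B (es @ fs)" "span (set (es @ fs)) = UNIV"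
    using orthonormal_extend[of UNIV es] es(1) by auto
  note o' = orthonormal_commute[OF o(1)]
  have s': "span (set (fs @ es)) = UNIV" using o(2) by (simp add: Un_commute)
  have lfs: "length fs = ?n - r"
    using dim_span_orthonormal[OF o(1)] es(2) unfolding o(2) by simp
  note perp = orthonormal_compl[OF o] orthonormal_compl[OF o' s']
  obtain fs' where fs': "orthonormal B fs'" "span (set fs') = span (set fs)"
    "\<And>\<eta>. sectional_curvature B \<eta> (span (set fs)) = \<eta> fs' fs'"
    using sectional_curvature_basis[OF subspace_span] by metis
  have lfs': "length fs' = ?n - r"
    using dim_span_orthonormal[OF fs'(1)] dim_span_orthonormal[of fs] fs'(2) o(1) lfs unfolding orthonormal_append by simp
  have e: "?n - 2 * q - r = ?n - r - 2 * q" by simp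
  have "pq_curvature B R r q (span (set es)) =
    1 / fact (?n - r - 2 * q) * df_mult (df_power (metric_form B) (?n - r - 2 * q)) (df_power R q) fs' fs'"
    unfolding pq_curvature_def perp fs'(3) e ..
  also have "\<dots> = (\<Sum>i\<le>2 * q. fact (?n - r - i) / fact (?n - r - 2 * q) * trace_sum (\<omega> i) (set fs'))"
    using r by (intro metric_power_decomposition_diag[OF dec fs'(1) lfs']) simp
  also have "\<dots> = (\<Sum>i\<le>2 * q. (-1) ^ i * fact (?n - r - i) / fact (?n - 2 * q - r) * trace_sum (\<omega> i) (set es))"
    using trace_sum_compl[OF eff orthonormal_replace[OF o fs'(1,2)]] by (intro sum.cong refl) (simp add: e add.commute mult.left_commute)
  finally show "pq_curvature B R r q (span (set es)) = \<dots>" .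
  obtain es' where es': "orthonormal B es'" "span (set es') = span (set es)"
    "\<And>\<eta>. sectional_curvature B \<eta> (span (set es)) = \<eta> es' es'"
    using sectional_curvature_basis[OF subspace_span] by metis
  have les': "length es' = r"
    using dim_span_orthonormal[OF es'(1)] dim_span_orthonormal[OF es(1)] es'(2) es(2) by simp
  have e: "?n - 2 * q - (?n - r) = r - 2 * q" using r by simp
  have "pq_curvature B R (?n - r) q (orth_compl B (span (set es))) =
    1 / fact (r - 2 * q) * df_mult (df_power (metric_form B) (r - 2 * q)) (df_power R q) es' es'"
    unfolding pq_curvature_def perp es'(3) e ..
  also have "\<dots> = (\<Sum>i\<le>2 * q. fact (r - i) / fact (r - 2 * q) * trace_sum (\<omega> i) (set es'))"
    using r by (intro metric_power_decomposition_diag[OF dec es'(1) les'])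
  also have "\<dots> = (\<Sum>i\<le>2 * q. fact (r - i) / fact (r - 2 * q) * trace_sum (\<omega> i) (set es))"
  proof (rule sum.cong[OF refl])
    fix i assume "i \<in> {..2 * q}"
    then have i: "i \<le> 2 * q" by simp
    \<comment> \<open>Both \<open>es\<close> and \<open>es'\<close> complete \<open>fs\<close> to a
      basis, so both sums equal \<open>(-1)^i\<close> times the one over \<open>fs\<close>.\<close>
    have "trace_sum (\<omega> i) (set es') = trace_sum (\<omega> i) (set es)"
      using trace_sum_compl[OF eff[OF i] orthonormal_replace[OF o' s' es'(1,2)]] trace_sum_compl[OF eff[OF i] o' s'] by simp
    then show "fact (r - i) / fact (r - 2 * q) * trace_sum (\<omega> i) (set es') =
      fact (r - i) / fact (r - 2 * q) * trace_sum (\<omega> i) (set es)" by simp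
  qed
  finally show "pq_curvature B R (DIM('v) - r) q (orth_compl B (span (set es))) = \<dots>" .
qed

lemma trace_sum_constant_iff:
  assumes dec: "effective_decomposition B p \<Omega> \<omega>" and bi: "bianchi \<Omega>" and d: "p \<le> d" "d + p \<le> DIM('v)"
  shows "(\<forall>es. orthonormal B es \<and> length es = d \<longrightarrow> (\<Sum>i\<le>p. c i * trace_sum (\<omega> i) (set es)) = lam) \<longleftrightarrow>
    (\<forall>i. 1 \<le> i \<and> i \<le> p \<and> c i \<noteq> 0 \<longrightarrow> \<omega> i = (\<lambda>xs ys. 0)) \<and> c 0 * \<omega> 0 [] [] = lam"
    (is "?L \<longleftrightarrow> ?R")
proof
  have eff: "\<omega> i \<in> effective_forms B i i" if "i \<le> p" for i
    using dec that by (simp add: effective_decomposition_def)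
  have \<Omega>: "\<Omega> xs ys = (\<Sum>i\<le>p. df_mult (df_power (metric_form B) (p - i)) (\<omega> i) xs ys)" for xs ys
    using dec by (simp add: effective_decomposition_def)
  {
    assume ?L
    then have s: "(\<Sum>i\<le>p. c i * (\<Sum>K\<in>Pow (set es). diag_value (\<omega> i) [] [] K)) = lam"
      if "orthonormal B es" "length es = d" for es
      using that by (simp add: trace_sum_def)
    show ?R
      using components_eq_0[where \<omega> = \<omega> and c = c, OF eff \<Omega> bi d s]
        separate_components(1)[where \<omega> = \<omega> and c = c, OF eff d s] by blast
  }
  assume R: ?R
  show ?L
  proof (intro allI impI)
    fix es
    \<comment> \<open>A form of degree 0 sees only empty lists, so its trace sum is the same for all
      planes.\<close>
    have "finite K \<Longrightarrow> K \<noteq> {} \<Longrightarrow> diag_value (\<omega> 0) [] [] K = 0" for K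
      using double_formsD(2)[of "\<omega> 0" 0 0 "list_of K"] eff[of 0] length_list_of[of K]
      by (auto simp: diag_value_def effective_forms_def)
    then have "trace_sum (\<omega> 0) (set es) = (\<Sum>K\<in>{{}}. diag_value (\<omega> 0) [] [] K)"
      unfolding trace_sum_def by (intro sum.mono_neutral_right) (auto dest: finite_subset)
    moreover have "list_of {} = ([] :: 'v list)" using list_of(2)[of "{}"] by simp
    ultimately have t0: "trace_sum (\<omega> 0) (set es) = \<omega> 0 [] []" by (simp add: diag_value_def)
    have "c i * trace_sum (\<omega> i) (set es) = 0" if "i \<in> {..p} - {0}" for i
    proof (cases "c i = 0")
      case False
      with R that have "\<omega> i = (\<lambda>xs ys. 0)" by simp
      then show ?thesis by (simp add: trace_sum_def diag_value_def)
    qed simp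
    then have "(\<Sum>i\<le>p. c i * trace_sum (\<omega> i) (set es)) = (\<Sum>i\<in>{0}. c i * trace_sum (\<omega> i) (set es))"
      by (intro sum.mono_neutral_right) auto
    then show "(\<Sum>i\<le>p. c i * trace_sum (\<omega> i) (set es)) = lam" using R t0 by simp
  qed
qed

section \<open>Constancy over all planes at a point\<close>

lemma planes_iff:
  "(\<forall>P. subspace P \<and> dim P = d \<longrightarrow> Q P) \<longleftrightarrow> (\<forall>es. orthonormal B es \<and> length es = d \<longrightarrow> Q (span (set es)))"
proof
  show "\<forall>P. subspace P \<and> dim P = d \<longrightarrow> Q P \<Longrightarrow> \<forall>es. orthonormal B es \<and> length es = d \<longrightarrow> Q (span (set es))"
    using dim_span_orthonormal subspace_span by metis
  show "\<forall>es. orthonormal B es \<and> length es = d \<longrightarrow> Q (span (set es)) \<Longrightarrow> \<forall>P. subspace P \<and> dim P = d \<longrightarrow> Q P"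
    using dim_span_orthonormal ex_orthonormal_basis by metis
qed

text \<open>The factor \<sigma> covers the difference and the sum of the two curvatures by one
  statement.\<close>

lemma pq_curvature_combination_iff:
  assumes dec: "effective_decomposition B (2 * q) (df_power R q) \<omega>" and bi: "bianchi R"
    and r: "2 * q \<le> r" "r + 2 * q \<le> DIM('v)"
    and c: "c = (\<lambda>i. (-1) ^ i * fact (DIM('v) - r - i) / fact (DIM('v) - 2 * q - r) + \<sigma> * (fact (r - i) / fact (r - 2 * q)))"
  shows "(\<forall>P. subspace P \<and> dim P = r \<longrightarrow>
      pq_curvature B R r q P + \<sigma> * pq_curvature B R (DIM('v) - r) q (orth_compl B P) = lam) \<longleftrightarrow>
    (\<forall>i. 1 \<le> i \<and> i \<le> 2 * q \<and> c i \<noteq> 0 \<longrightarrow> \<omega> i = (\<lambda>xs ys. 0)) \<and> c 0 * \<omega> 0 [] [] = lam"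
proof -
  have "pq_curvature B R r q (span (set es)) + \<sigma> * pq_curvature B R (DIM('v) - r) q (orth_compl B (span (set es))) =
      (\<Sum>i\<le>2 * q. c i * trace_sum (\<omega> i) (set es))" if "orthonormal B es" "length es = r" for es
    unfolding pq_curvature_pair[OF dec r that] c
    by (simp add: sum_distrib_left distrib_right mult.assoc sum.distrib)
  then show ?thesis
    unfolding planes_iff trace_sum_constant_iff[OF dec bianchi_df_power[OF bi] r, of c lam, symmetric] by auto
qed

text \<open>Here the planes have dimension p and the coefficients \<open>(p - i)!\<close> are all
  nonzero, so no component of positive degree can survive.\<close>

lemma sectional_curvature_constant_iff:
  assumes dec: "effective_decomposition B p \<Omega> \<omega>" and bi: "bianchi \<Omega>" and p: "2 * p \<le> DIM('v)"
  shows "(\<forall>P. subspace P \<and> dim P = p \<longrightarrow> sectional_curvature B \<Omega> P = \<kappa>) \<longleftrightarrow>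
    (\<forall>i. 1 \<le> i \<and> i \<le> p \<longrightarrow> \<omega> i = (\<lambda>xs ys. 0)) \<and> fact p * \<omega> 0 [] [] = \<kappa>"
proof -
  have eff: "\<omega> i \<in> effective_forms B i i" if "i \<le> p" for i
    using dec that by (simp add: effective_decomposition_def)
  have "sectional_curvature B \<Omega> (span (set es)) = (\<Sum>i\<le>p. fact (p - i) * trace_sum (\<omega> i) (set es))"
    if es: "orthonormal B es" "length es = p" for es
  proof -
    obtain fs where o: "orthonormal B (es @ fs)" "span (set (es @ fs)) = UNIV"
      using orthonormal_extend[of UNIV es] es(1) by auto
    note o' = orthonormal_commute[OF o(1)]
    have s': "span (set (fs @ es)) = UNIV" using o(2) by (simp add: Un_commute)
    obtain es' where es': "orthonormal B es'" "span (set es') = span (set es)"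
      "\<And>\<eta>. sectional_curvature B \<eta> (span (set es)) = \<eta> es' es'"
      using sectional_curvature_basis[OF subspace_span] by metis
    have les': "length es' = p"
      using dim_span_orthonormal[OF es'(1)] dim_span_orthonormal[OF es(1)] es'(2) es(2) by simp
    have "trace_sum (\<omega> i) (set es') = trace_sum (\<omega> i) (set es)" if "i \<le> p" for i
      using trace_sum_compl[OF eff[OF that] orthonormal_replace[OF o' s' es'(1,2)]] trace_sum_compl[OF eff[OF that] o' s'] by simp
    then show ?thesis unfolding es'(3) decomposition_diag[OF dec es'(1) les'] by simp
  qed
  then show ?thesis
    unfolding planes_iff using trace_sum_constant_iff[OF dec bi order_refl, of "\<lambda>i. fact (p - i)" \<kappa>] p by auto
qed

end


section \<open>The Riemann tensor\<close>

text \<open>Symmetry of the Gram matrix is available only on the image of a chart; openness lets it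
  pass to derivatives. Both functions have the same set of derivatives at x, hence the same chosen
  one.\<close>

lemma partial_deriv_cong:
  assumes "open U" "x \<in> U" "\<And>y. y \<in> U \<Longrightarrow> f y = g y"
  shows "partial_deriv i f x = partial_deriv i g x"
proof -
  have "(f has_derivative D) (at x) \<longleftrightarrow> (g has_derivative D) (at x)" for D
    using assms by (metis has_derivative_transform_within_open)
  then show ?thesis unfolding partial_deriv_def frechet_derivative_def by simp
qed

lemma christoffel_sym:
  assumes "open U" "x \<in> U" "\<And>y i j. y \<in> U \<Longrightarrow> g y $ i $ j = g y $ j $ i"
  shows "christoffel g l i j x = christoffel g l j i x"
proof -
  have "partial_deriv k (\<lambda>y. g y $ i $ j) x = partial_deriv k (\<lambda>y. g y $ j $ i) x" for k
    using assms by (intro partial_deriv_cong[of U]) auto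
  then show ?thesis unfolding christoffel_def by (simp add: add.commute)
qed

text \<open>The Christoffel symbols are symmetric in the lower indices, that is, the connection is
  torsion free; all terms of the cyclic sum then cancel in pairs.\<close>

lemma curvature_coeff_cyclic:
  assumes U: "open U" "x \<in> U" and g: "\<And>y i j. y \<in> U \<Longrightarrow> g y $ i $ j = g y $ j $ i"
  shows "curvature_coeff g l k i j x + curvature_coeff g l i j k x + curvature_coeff g l j k i x = 0"
proof -
  have c: "christoffel g l i j y = christoffel g l j i y" if "y \<in> U" for l i j y
    using christoffel_sym[OF U(1) that, of g] g by blast
  have d: "partial_deriv a (christoffel g l i j) x = partial_deriv a (christoffel g l j i) x" for a i j
    using c U by (intro partial_deriv_cong[of U]) auto
  have s: "christoffel g l i j x = christoffel g l j i x" for l i j using c U by blast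
  show ?thesis
    unfolding curvature_coeff_def sum_subtractf
    by (simp add: d[of i k j] d[of j k i] d[of k j i] s[of _ k j] s[of _ k i] s[of _ j i])
qed

lemma curvature_coeff_antisym: "curvature_coeff g l k j i x = - curvature_coeff g l k i j x"
  unfolding curvature_coeff_def sum_subtractf by simp

text \<open>The cyclic identity with \<open>R(w, u) v\<close> written as \<open>- R(u, w) v\<close>,
  which is the sign pattern of \<open>bianchi_sum\<close> on \<open>[u, v, w]\<close>.\<close>

lemma curvature_operator_cyclic:
  assumes U: "open U" "x \<in> U" and g: "\<And>y i j. y \<in> U \<Longrightarrow> g y $ i $ j = g y $ j $ i"
  shows "curvature_operator g x v w u - curvature_operator g x u w v + curvature_operator g x u v w = 0"
proof -
  have "(\<Sum>i\<in>UNIV. \<Sum>j\<in>UNIV. \<Sum>k\<in>UNIV. curvature_coeff g l k i j x * v $ i * w $ j * u $ k)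
      = (\<Sum>i\<in>UNIV. \<Sum>j\<in>UNIV. \<Sum>k\<in>UNIV. curvature_coeff g l i j k x * u $ i * v $ j * w $ k)" for l
  proof -
    have "(\<Sum>i\<in>UNIV. \<Sum>j\<in>UNIV. \<Sum>k\<in>UNIV. curvature_coeff g l i j k x * u $ i * v $ j * w $ k)
      = (\<Sum>j\<in>UNIV. \<Sum>i\<in>UNIV. \<Sum>k\<in>UNIV. curvature_coeff g l i j k x * u $ i * v $ j * w $ k)"
      by (rule sum.swap)
    also have "\<dots> = (\<Sum>j\<in>UNIV. \<Sum>k\<in>UNIV. \<Sum>i\<in>UNIV. curvature_coeff g l i j k x * u $ i * v $ j * w $ k)"
      by (rule sum.cong[OF refl], rule sum.swap)
    finally show ?thesis by (simp add: mult_ac)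
  qed
  moreover have "(\<Sum>i\<in>UNIV. \<Sum>j\<in>UNIV. \<Sum>k\<in>UNIV. curvature_coeff g l k i j x * u $ i * w $ j * v $ k)
      = - (\<Sum>i\<in>UNIV. \<Sum>j\<in>UNIV. \<Sum>k\<in>UNIV. curvature_coeff g l j k i x * u $ i * v $ j * w $ k)" for l
  proof -
    have "(\<Sum>i\<in>UNIV. \<Sum>j\<in>UNIV. \<Sum>k\<in>UNIV. curvature_coeff g l k i j x * u $ i * w $ j * v $ k)
      = (\<Sum>i\<in>UNIV. \<Sum>k\<in>UNIV. \<Sum>j\<in>UNIV. curvature_coeff g l k i j x * u $ i * w $ j * v $ k)"
      by (rule sum.cong[OF refl], rule sum.swap)
    also have "\<dots> = (\<Sum>i\<in>UNIV. \<Sum>k\<in>UNIV. \<Sum>j\<in>UNIV. - (curvature_coeff g l k j i x * u $ i * v $ k * w $ j))"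
    proof -
      have "curvature_coeff g l k i j x * u $ i * w $ j * v $ k = - (curvature_coeff g l k j i x * u $ i * v $ k * w $ j)" for i j k
        using curvature_coeff_antisym[of g l k i j x] by simp
      then show ?thesis by (simp only:)
    qed
    finally show ?thesis by (simp only: sum_negf)
  qed
  ultimately have "(\<Sum>i\<in>UNIV. \<Sum>j\<in>UNIV. \<Sum>k\<in>UNIV. curvature_coeff g l k i j x * v $ i * w $ j * u $ k)
     - (\<Sum>i\<in>UNIV. \<Sum>j\<in>UNIV. \<Sum>k\<in>UNIV. curvature_coeff g l k i j x * u $ i * w $ j * v $ k)
     + (\<Sum>i\<in>UNIV. \<Sum>j\<in>UNIV. \<Sum>k\<in>UNIV. curvature_coeff g l k i j x * u $ i * v $ j * w $ k)
    = (\<Sum>i\<in>UNIV. \<Sum>j\<in>UNIV. \<Sum>k\<in>UNIV. (curvature_coeff g l k i j x + curvature_coeff g l i j k x + curvature_coeff g l j k i x)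
        * u $ i * v $ j * w $ k)" for l
    by (simp add: distrib_right sum.distrib)
  then show ?thesis
    by (simp add: vec_eq_iff curvature_operator_def curvature_coeff_cyclic[OF U g])
qed

lemma riemannian_chart:
  assumes M: "riemannian_manifold X \<A> G" and c: "c \<in> \<A>" "m \<in> fst c"
  shows "inner_product (tangent_metric G c m)" "bianchi (riemann_tensor G c m)"
proof -
  have sym: "tangent_metric G c m v w = tangent_metric G c m w v"
    and pos: "v \<noteq> 0 \<Longrightarrow> 0 < tangent_metric G c m v v"
    if "m \<in> fst c" for m v w
    using M c(1) that unfolding riemannian_manifold_def by blast+
  show "inner_product (tangent_metric G c m)"
  proof (rule inner_product.intro)
    show "linear (\<lambda>v. tangent_metric G c m v w)" for w
      unfolding tangent_metric_def by (intro linearI) (auto simp: inner_left_distrib)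
  qed (use sym pos c(2) in auto)
  let ?U = "snd c ` fst c"
  have "open ?U" using M c(1) unfolding riemannian_manifold_def smooth_manifold_def is_chart_def by blast
  \<comment> \<open>Evaluating the symmetric form on coordinate vectors gives symmetry of the matrix
    on the whole open image, as required for differentiating it.\<close>
  have "G c y $ i $ j = G c y $ j $ i" if y: "y \<in> ?U" for y i j
  proof -
    from y obtain m' where "m' \<in> fst c" "y = snd c m'" by blast
    then show ?thesis using sym[of m' "axis i 1" "axis j 1"]
      by (simp add: tangent_metric_def matrix_vector_mul_component inner_axis inner_commute[of "axis _ _"] inner_axis' )
  qed
  note cyc = curvature_operator_cyclic[where g = "G c", OF \<open>open ?U\<close> imageI[OF c(2)] this]
  have lin: "linear (\<lambda>v. tangent_metric G c m v y)" for y
    unfolding tangent_metric_def by (intro linearI) (auto simp: inner_left_distrib)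
  show "bianchi (riemann_tensor G c m)"
    unfolding bianchi_def
  proof (intro allI)
    fix xs ys
    show "bianchi_sum (\<lambda>v a. riemann_tensor G c m a (ys @ [v])) xs = 0"
    proof (cases "length xs = 3 \<and> length ys = 1")
      case True
      then obtain u v w y where xs: "xs = [u, v, w]" and ys: "ys = [y]"
        by (auto simp: length_Suc_conv eval_nat_numeral)
      let ?R = "curvature_operator (G c) (snd c m)"
      \<comment> \<open>The appended vector is the one on which the curvature operator acts, while
        \<open>y\<close> is only paired with the result.\<close>
      have "bianchi_sum (\<lambda>v a. riemann_tensor G c m a (ys @ [v])) xs =
        tangent_metric G c m (?R v w u) y - tangent_metric G c m (?R u w v) y + tangent_metric G c m (?R u v w) y"
        by (simp add: xs ys riemann_tensor_def)
      also have "\<dots> = tangent_metric G c m (?R v w u - ?R u w v + ?R u v w) y"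
        by (simp add: linear_add[OF lin] linear_diff[OF lin])
      finally show ?thesis by (simp add: cyc linear_0[OF lin])
    next
      case False
      have "bianchi_sum (\<lambda>v a. riemann_tensor G c m a (ys @ [v])) xs = bianchi_sum (\<lambda>v a. 0) xs"
      proof (rule bianchi_sum_cong)
        fix v a assume "mset (v # a) = mset xs"
        from mset_eq_length[OF this] False
        show "riemann_tensor G c m a (ys @ [v]) = 0" by (auto simp: riemann_tensor_def)
      qed
      then show ?thesis by simp
    qed
  qed
qed

text \<open>The quotient is the product of the k factors t + 1, ..., t + k, each increasing in
  t.\<close>

lemma fact_quotient_less:
  assumes "s < t" "0 < k"
  shows "fact (s + k) / fact s < (fact (t + k) / fact t :: real)"
proof -
  have "fact (s + Suc k) / fact s < (fact (t + Suc k) / fact t :: real)" for k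
  proof (induction k)
    case 0
    then show ?case using assms(1) by (simp add: fact_Suc)
  next
    case (Suc k)
    have "real (s + Suc (Suc k)) * (fact (s + Suc k) / fact s) < real (t + Suc (Suc k)) * (fact (t + Suc k) / fact t)"
      using Suc assms(1) by (intro mult_strict_mono) auto
    then show ?case by (simp add: fact_Suc)
  qed
  from this[of "k - 1"] show ?thesis using assms(2) by simp
qed

text \<open>Applied with m = n - r, m' = r and p = 2q to compare the coefficients of the two
  curvatures. For i = p both quotients would be 1.\<close>

lemma fact_quotient_neq:
  assumes "m \<noteq> m'" "p \<le> m" "p \<le> m'" "i < p"
  shows "fact (m - i) / fact (m - p) \<noteq> (fact (m' - i) / fact (m' - p) :: real)"
proof -
  have *: "fact (a - i) / fact (a - p) < (fact (b - i) / fact (b - p) :: real)" if "a < b" "p \<le> a" for a b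
    using fact_quotient_less[of "a - p" "b - p" "p - i"] that assms(4) by simp
  show ?thesis using *[of m m'] *[of m' m] assms(1-3) by linarith
qed

lemma tangent_planes_iff:
  "(\<forall>(c, m, P)\<in>tangent_planes \<A> r. Q c m P) \<longleftrightarrow>
    (\<forall>c\<in>\<A>. \<forall>m\<in>fst c. \<forall>P. subspace P \<and> dim P = r \<longrightarrow> Q c m P)"
  unfolding tangent_planes_def by auto

theorem theorem5p8:
  fixes X :: "'a topology"
    and \<A> :: "('a, 'n::finite) chart set"
    and G :: "('a, 'n) metric_tensor"
    and \<omega> :: "('a, 'n) chart \<Rightarrow> 'a \<Rightarrow> nat \<Rightarrow> (real^'n) double_form"
    and n q r :: nat
    and lam :: real
  assumes M: "riemannian_manifold X \<A> G"
    and n: "n = CARD('n)"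
    and q: "1 \<le> q"
    and r: "2 * q \<le> r" "r + 2 * q \<le> n"
    and \<omega>: "\<And>c m. c \<in> \<A> \<Longrightarrow> m \<in> fst c \<Longrightarrow>
      effective_decomposition (tangent_metric G c m) (2 * q)
        (df_power (riemann_tensor G c m) q) (\<omega> c m)"
  shows "(n \<noteq> 2 * r \<longrightarrow>
      ((\<forall>(c, m, P)\<in>tangent_planes \<A> r.
          s_curvature G r q c m P - s_curvature G (n - r) q c m (tangent_perp G c m P) = lam) \<longleftrightarrow>
       (\<forall>c\<in>\<A>. \<forall>m\<in>fst c.
          (\<forall>i. 1 \<le> i \<and> i \<le> 2 * q - 1 \<longrightarrow> \<omega> c m i = (\<lambda>xs ys. 0)) \<and>
          (fact (n - r) / fact (n - 2 * q - r) - fact r / fact (r - 2 * q)) * \<omega> c m 0 [] [] = lam)) \<and>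
      ((\<forall>(c, m, P)\<in>tangent_planes \<A> r.
          s_curvature G r q c m P + s_curvature G (n - r) q c m (tangent_perp G c m P) = lam) \<longleftrightarrow>
       (\<forall>c\<in>\<A>. \<forall>m\<in>fst c.
          (\<forall>i. 1 \<le> i \<and> i \<le> 2 * q \<longrightarrow> \<omega> c m i = (\<lambda>xs ys. 0)) \<and>
          (fact (n - r) / fact (n - 2 * q - r) + fact r / fact (r - 2 * q)) * \<omega> c m 0 [] [] = lam)) \<and>
      ((\<exists>\<mu>. \<forall>c\<in>\<A>. \<forall>m\<in>fst c.
          (\<forall>i. 1 \<le> i \<and> i \<le> 2 * q \<longrightarrow> \<omega> c m i = (\<lambda>xs ys. 0)) \<and>
          (fact (n - r) / fact (n - 2 * q - r) + fact r / fact (r - 2 * q)) * \<omega> c m 0 [] [] = \<mu>) \<longleftrightarrow>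
       Rq_constant_sectional_curvature \<A> G q)) \<and>
    (n = 2 * r \<longrightarrow>
      ((\<forall>(c, m, P)\<in>tangent_planes \<A> r.
          s_curvature G r q c m P - s_curvature G r q c m (tangent_perp G c m P) = lam) \<longleftrightarrow>
       (\<forall>c\<in>\<A>. \<forall>m\<in>fst c.
          \<forall>i. odd i \<and> 1 \<le> i \<and> i \<le> 2 * q - 1 \<longrightarrow> \<omega> c m i = (\<lambda>xs ys. 0)) \<and> lam = 0) \<and>
      ((\<forall>(c, m, P)\<in>tangent_planes \<A> r.
          s_curvature G r q c m P + s_curvature G r q c m (tangent_perp G c m P) = lam) \<longleftrightarrow>
       (\<forall>c\<in>\<A>. \<forall>m\<in>fst c.
          (\<forall>i. even i \<and> 2 \<le> i \<and> i \<le> 2 * q \<longrightarrow> \<omega> c m i = (\<lambda>xs ys. 0)) \<and>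
          2 * (fact r / fact (r - 2 * q)) * \<omega> c m 0 [] [] = lam)))"
proof -
  \<comment> \<open>Up to the sign \<open>(-1)^i\<close> of the first, \<open>a i\<close> and
    \<open>b i\<close> are the weights of the i-th component in the two curvatures;
    \<open>cf \<sigma> i\<close> is its weight in their combination.\<close>
  define a :: "nat \<Rightarrow> real" where "a = (\<lambda>i. fact (n - r - i) / fact (n - 2 * q - r))"
  define b :: "nat \<Rightarrow> real" where "b = (\<lambda>i. fact (r - i) / fact (r - 2 * q))"
  define cf where "cf = (\<lambda>\<sigma> i. (-1) ^ i * fact (n - r - i) / fact (n - 2 * q - r) + \<sigma> * (fact (r - i) / fact (r - 2 * q)) :: real)"
  have cf: "cf \<sigma> i = (-1) ^ i * a i + \<sigma> * b i" for \<sigma> i by (simp add: cf_def a_def b_def)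
  have pos: "0 < a i" "0 < b i" for i by (simp_all add: a_def b_def)
  have dim: "DIM(real^'n) = n" by (simp add: n)
  have comb: "(\<forall>(c, m, P)\<in>tangent_planes \<A> r.
        s_curvature G r q c m P + \<sigma> * s_curvature G (n - r) q c m (tangent_perp G c m P) = lam) \<longleftrightarrow>
      (\<forall>c\<in>\<A>. \<forall>m\<in>fst c. (\<forall>i. 1 \<le> i \<and> i \<le> 2 * q \<and> cf \<sigma> i \<noteq> 0 \<longrightarrow> \<omega> c m i = (\<lambda>xs ys. 0)) \<and>
         cf \<sigma> 0 * \<omega> c m 0 [] [] = lam)" for \<sigma> lam
    unfolding tangent_planes_iff
  proof (intro ball_cong refl)
    fix c m assume cm: "c \<in> \<A>" "m \<in> fst c"
    show "(\<forall>P. subspace P \<and> dim P = r \<longrightarrow>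
        s_curvature G r q c m P + \<sigma> * s_curvature G (n - r) q c m (tangent_perp G c m P) = lam) \<longleftrightarrow>
      (\<forall>i. 1 \<le> i \<and> i \<le> 2 * q \<and> cf \<sigma> i \<noteq> 0 \<longrightarrow> \<omega> c m i = (\<lambda>xs ys. 0)) \<and> cf \<sigma> 0 * \<omega> c m 0 [] [] = lam"
      using inner_product.pq_curvature_combination_iff[OF riemannian_chart(1)[OF M cm] \<omega>[OF cm]
          riemannian_chart(2)[OF M cm] r(1) _ refl, of \<sigma> lam] r(2)
      unfolding s_curvature_def tangent_perp_def dim cf_def by blast
  qed
  have minus: "(\<forall>(c, m, P)\<in>tangent_planes \<A> r.
        s_curvature G r q c m P - s_curvature G (n - r) q c m (tangent_perp G c m P) = lam) \<longleftrightarrow>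
      (\<forall>c\<in>\<A>. \<forall>m\<in>fst c. (\<forall>i. 1 \<le> i \<and> i \<le> 2 * q \<and> cf (-1) i \<noteq> 0 \<longrightarrow> \<omega> c m i = (\<lambda>xs ys. 0)) \<and>
         cf (-1) 0 * \<omega> c m 0 [] [] = lam)" for lam
    using comb[of "-1" lam] by simp
  have plus: "(\<forall>(c, m, P)\<in>tangent_planes \<A> r.
        s_curvature G r q c m P + s_curvature G (n - r) q c m (tangent_perp G c m P) = lam) \<longleftrightarrow>
      (\<forall>c\<in>\<A>. \<forall>m\<in>fst c. (\<forall>i. 1 \<le> i \<and> i \<le> 2 * q \<and> cf 1 i \<noteq> 0 \<longrightarrow> \<omega> c m i = (\<lambda>xs ys. 0)) \<and>
         cf 1 0 * \<omega> c m 0 [] [] = lam)" for lam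
    using comb[of 1 lam] by simp
  have cf0: "cf (-1) 0 = fact (n - r) / fact (n - 2 * q - r) - fact r / fact (r - 2 * q)"
    "cf 1 0 = fact (n - r) / fact (n - 2 * q - r) + fact r / fact (r - 2 * q)" by (simp_all add: cf_def)
  have e: "n - 2 * q - r = n - r - 2 * q" by simp
  \<comment> \<open>The exponent 2q is even and both weights are 1, so the top component cancels
    from the difference and is doubled in the sum.\<close>
  have ab: "a (2 * q) = 1" "b (2 * q) = 1" by (simp_all add: a_def b_def add.commute)
  have const: "Rq_constant_sectional_curvature \<A> G q \<longleftrightarrow> (\<exists>\<kappa>. \<forall>c\<in>\<A>. \<forall>m\<in>fst c.
      (\<forall>i. 1 \<le> i \<and> i \<le> 2 * q \<longrightarrow> \<omega> c m i = (\<lambda>xs ys. 0)) \<and> fact (2 * q) * \<omega> c m 0 [] [] = \<kappa>)"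
    unfolding Rq_constant_sectional_curvature_def tangent_planes_iff
  proof (intro ex_cong1 ball_cong refl)
    fix \<kappa> c m assume cm: "c \<in> \<A>" "m \<in> fst c"
    show "(\<forall>P. subspace P \<and> dim P = 2 * q \<longrightarrow>
        sectional_curvature (tangent_metric G c m) (df_power (riemann_tensor G c m) q) P = \<kappa>) \<longleftrightarrow>
      (\<forall>i. 1 \<le> i \<and> i \<le> 2 * q \<longrightarrow> \<omega> c m i = (\<lambda>xs ys. 0)) \<and> fact (2 * q) * \<omega> c m 0 [] [] = \<kappa>"
      by (rule inner_product.sectional_curvature_constant_iff[OF riemannian_chart(1)[OF M cm] \<omega>[OF cm]
          bianchi_df_power[OF riemannian_chart(2)[OF M cm]]]) (use r dim in simp)
  qed
  show ?thesis
  proof (intro conjI impI)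
    assume ne: "n \<noteq> 2 * r"
    have neq: "a i \<noteq> b i" if "i < 2 * q" for i
      unfolding a_def b_def e by (rule fact_quotient_neq) (use that r ne in auto)
    have "(1 \<le> i \<and> i \<le> 2 * q \<and> cf (-1) i \<noteq> 0) \<longleftrightarrow> (1 \<le> i \<and> i \<le> 2 * q - 1)" for i
    proof (cases "i < 2 * q")
      case True
      then show ?thesis using neq[of i] pos[of i] by (cases "even i") (auto simp: cf)
    next
      case False
      then show ?thesis using ab q by (cases "i = 2 * q") (auto simp: cf)
    qed
    then show "(\<forall>(c, m, P)\<in>tangent_planes \<A> r.
          s_curvature G r q c m P - s_curvature G (n - r) q c m (tangent_perp G c m P) = lam) \<longleftrightarrow>
       (\<forall>c\<in>\<A>. \<forall>m\<in>fst c.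
          (\<forall>i. 1 \<le> i \<and> i \<le> 2 * q - 1 \<longrightarrow> \<omega> c m i = (\<lambda>xs ys. 0)) \<and>
          (fact (n - r) / fact (n - 2 * q - r) - fact r / fact (r - 2 * q)) * \<omega> c m 0 [] [] = lam)"
      unfolding minus cf0 by simp
    have "(1 \<le> i \<and> i \<le> 2 * q \<and> cf 1 i \<noteq> 0) \<longleftrightarrow> (1 \<le> i \<and> i \<le> 2 * q)" for i
    proof (cases "i < 2 * q")
      case True
      then show ?thesis using neq[of i] pos[of i] by (cases "even i") (auto simp: cf)
    next
      case False
      then show ?thesis using ab by (cases "i = 2 * q") (auto simp: cf)
    qed
    then show "(\<forall>(c, m, P)\<in>tangent_planes \<A> r.
          s_curvature G r q c m P + s_curvature G (n - r) q c m (tangent_perp G c m P) = lam) \<longleftrightarrow>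
       (\<forall>c\<in>\<A>. \<forall>m\<in>fst c.
          (\<forall>i. 1 \<le> i \<and> i \<le> 2 * q \<longrightarrow> \<omega> c m i = (\<lambda>xs ys. 0)) \<and>
          (fact (n - r) / fact (n - 2 * q - r) + fact r / fact (r - 2 * q)) * \<omega> c m 0 [] [] = lam)"
      unfolding plus cf0 by simp
    let ?C = "fact (n - r) / fact (n - 2 * q - r) + fact r / fact (r - 2 * q) :: real"
    have C: "?C > 0" by (intro add_pos_pos) auto
    \<comment> \<open>Both scalar conditions prescribe a positive multiple of the degree 0
      component, by \<open>?C\<close> and by \<open>(2q)!\<close>. Their quotient converts \<mu>
      into \<kappa> and back.\<close>
    have quot: "f * x = f * \<mu> / C" if "C * x = \<mu>" "C > 0" for f x \<mu> C :: real
      using that by auto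
    show "(\<exists>\<mu>. \<forall>c\<in>\<A>. \<forall>m\<in>fst c.
          (\<forall>i. 1 \<le> i \<and> i \<le> 2 * q \<longrightarrow> \<omega> c m i = (\<lambda>xs ys. 0)) \<and> ?C * \<omega> c m 0 [] [] = \<mu>) \<longleftrightarrow>
       Rq_constant_sectional_curvature \<A> G q" (is "(\<exists>\<mu>. ?M \<mu>) \<longleftrightarrow> _")
    proof
      assume "\<exists>\<mu>. ?M \<mu>"
      then obtain \<mu> where \<mu>: "?M \<mu>" ..
      from quot[OF _ C, of _ _ "fact (2 * q)"] have "fact (2 * q) * x = fact (2 * q) * \<mu> / ?C" if "?C * x = \<mu>" for x
        using that .
      with \<mu> show "Rq_constant_sectional_curvature \<A> G q" unfolding const by blast
    next
      assume "Rq_constant_sectional_curvature \<A> G q"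
      then obtain \<kappa> where \<kappa>: "\<forall>c\<in>\<A>. \<forall>m\<in>fst c.
        (\<forall>i. 1 \<le> i \<and> i \<le> 2 * q \<longrightarrow> \<omega> c m i = (\<lambda>xs ys. 0)) \<and> fact (2 * q) * \<omega> c m 0 [] [] = \<kappa>"
        unfolding const by blast
      have "(0 :: real) < fact (2 * q)" by simp
      from quot[OF _ this, of _ _ ?C] have "?C * x = ?C * \<kappa> / fact (2 * q)" if "fact (2 * q) * x = \<kappa>" for x
        using that .
      with \<kappa> show "\<exists>\<mu>. ?M \<mu>" by blast
    qed
  next
    assume n2: "n = 2 * r"
    then have nr: "n - r = r" by simp
    have eq: "a i = b i" for i by (simp add: a_def b_def n2)
    \<comment> \<open>The equation \<open>lam = 0\<close> stands outside the quantifiers over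
      points; a point of the manifold is needed to derive it.\<close>
    obtain c m where cm: "c \<in> \<A>" "m \<in> fst c"
      using M unfolding riemannian_manifold_def smooth_manifold_def by blast
    have "(1 \<le> i \<and> i \<le> 2 * q \<and> cf (-1) i \<noteq> 0) \<longleftrightarrow> (odd i \<and> 1 \<le> i \<and> i \<le> 2 * q - 1)" for i
    proof (cases "even i")
      case False
      then have "i \<noteq> 2 * q" by auto
      then show ?thesis using False pos[of i] by (auto simp: cf)
    qed (simp add: cf eq)
    moreover have "cf (-1) 0 = 0" by (simp add: cf eq)
    ultimately show "(\<forall>(c, m, P)\<in>tangent_planes \<A> r.
          s_curvature G r q c m P - s_curvature G r q c m (tangent_perp G c m P) = lam) \<longleftrightarrow>
       (\<forall>c\<in>\<A>. \<forall>m\<in>fst c.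
          \<forall>i. odd i \<and> 1 \<le> i \<and> i \<le> 2 * q - 1 \<longrightarrow> \<omega> c m i = (\<lambda>xs ys. 0)) \<and> lam = 0"
      unfolding minus[unfolded nr] using cm by auto
    have "(1 \<le> i \<and> i \<le> 2 * q \<and> cf 1 i \<noteq> 0) \<longleftrightarrow> (even i \<and> 2 \<le> i \<and> i \<le> 2 * q)" for i
    proof (cases "even i")
      case True
      then have "1 \<le> i \<longleftrightarrow> 2 \<le> i" by (cases "i = 1") auto
      moreover have "cf 1 i \<noteq> 0" using True pos[of i] by (simp add: cf)
      ultimately show ?thesis using True by auto
    qed (simp add: cf eq)
    moreover have "cf 1 0 = 2 * (fact r / fact (r - 2 * q))" by (simp add: cf eq) (simp add: b_def)
    ultimately show "(\<forall>(c, m, P)\<in>tangent_planes \<A> r.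
          s_curvature G r q c m P + s_curvature G r q c m (tangent_perp G c m P) = lam) \<longleftrightarrow>
       (\<forall>c\<in>\<A>. \<forall>m\<in>fst c.
          (\<forall>i. even i \<and> 2 \<le> i \<and> i \<le> 2 * q \<longrightarrow> \<omega> c m i = (\<lambda>xs ys. 0)) \<and>
          2 * (fact r / fact (r - 2 * q)) * \<omega> c m 0 [] [] = lam)"
      unfolding plus[unfolded nr] by simp
  qed
qed

end
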